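(* (Safety) For every execution of the Ctrie algorithm described in the context, by any number of threads concurrently invoking insert, lookup and remove starting from the empty Ctrie ($root = null$): at every time $t$ the Ctrie is in a valid state (invariants INV1–INV5 hold), and this state is consistent with some abstract set $\mathbb{A}$; moreover all Ctrie operations are consistent with the semantics of the abstract set $\mathbb{A}$ (insert/remove change the state into one consistent with $\mathbb{A}\cup\{k\}$, respectively $\mathbb{A}\setminus\{k\}$, and lookup returns a value for $k$ exactly when $k\in\mathbb{A}$).
   Context: Setting. A Ctrie is a concurrent shared-memory map from keys to values, accessed by several threads using atomic reads and single-word compare-and-swap, written CAS$(x,e,n)$: atomically, if location $x$ holds $e$ then write $n$ and succeed, otherwise fail. Keys have hashcodes (bit strings). Fix the branching width $W\ge1$. The hashcode chunk of key $k$ at level $l$ (levels are multiples of $W$) is $m(l,k)=(hashcode(k)\gg l)\bmod 2^W$. Nodes. An inode has one mutable field $main$, holding $null$, a cnode or an snode. A cnode has an integer bitmap $bmp$ of $2^W$ bits and an array of references to inodes or snodes. An snode has a key $k$, a value $v$ and a boolean $tomb$; a tombed snode is written $sn\dagger$. Fields of cnodes and snodes are set only at creation. A mutable reference $root$ holds $null$ or an inode. For a cnode $cn$ and $r<2^W$: $cn.flg(r)$ iff bit $r$ of $cn.bmp$ is set; $cn.arr(r)=cn.array(\#(((1\ll r)-1)\wedge cn.bmp))$ where $\#$ is the bit count and $\wedge$ bitwise AND; for a cnode at level $l$, $cn.sub(k)=cn.arr(m(l,k))$ if $cn.flg(m(l,k))$, else $null$. A node is at level $l$ if there are $l/W$ cnodes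 on the path from the root inode to it; the root inode has hashcode prefix $\epsilon$, and a node reached from its closest ancestor cnode $cn_{l,q}$ via $cn_{l,q}.arr(r)$ has level $l+W$ and prefix $q\cdot r$; $n_{l,p}$ denotes a node at level $l$ with prefix $p$. Terminology. A null-inode is an inode with $main=null$; a tomb-inode is an inode with $main$ a tombed snode. A node is live iff it is a cnode, an untombed snode, or an inode whose $main$ is a cnode; otherwise nonlive. A singleton is an snode or a tomb-inode. Algorithm (restart means re-invoke the top-level operation). insert$(k,v)$: read $r=root$; if $r=null$ or $r$ is a null-inode, CAS $root$ from $r$ to a new inode whose $main$ is a new cnode containing only a new untombed snode $(k,v)$, restarting on failure; otherwise call iinsert$(r,k,v,0,null)$ and restart if it fails. iinsert$(i,k,v,lev,parent)$: read $cn=i.main$. If it is a cnode: if the flag for $m(lev,k)$ is unset, return the result of CAS $i.main$ from $cn$ to a copy of $cn$ with a new snode $(k,v)$ inserted at that flag; if the entry is an inode, recurse with level $lev+W$ and parent $i$; if the entry is an untombed snode $sn$ with $sn.k=k$, return the result of CAS $i.main$ from $cn$ to a copy with that entry replaced by a new snode $(k,v)$; if $sn.k\ne k$, return the result of CAS $i.main$ from $cn$ to a copy with that entry replaced by a new inode whose $main$ is a new cnode at level $lev+W$ containing $sn$ and a new snode $(k,v)$ (with deeper levels if chunks coincide). If $i.main$ is a tombed snode or $null$: call clean$(parent)$ if $parent\ne null$, and fail. lookup$(k)$ / remove$(k)$: read $r=root$; if $r=null$ return NOTFOUND; if $r$ is a null-inode, CAS $root$ from $r$ to $null$ and restart; otherwise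 call ilookup$(r,k,0,null)$ / iremove$(r,k,0,null)$ and restart if the result is RESTART. ilookup$(i,k,lev,parent)$: read $i.main$; if it is a cnode $cn$: return NOTFOUND if the flag is unset; recurse on an inode entry; on an untombed snode entry return its value if its key is $k$, else NOTFOUND. If $i.main$ is a tombed snode or $null$: clean$(parent)$ if $parent\ne null$, return RESTART. iremove$(i,k,lev,parent)$: as ilookup, except that on an untombed snode entry $sn$ with $sn.k=k$ it CASes $i.main$ from $cn$ to a copy without that entry (or to $null$ if $cn$ had a single entry), returning RESTART on failure; after a successful removal, if $parent\ne null$ it calls tombCompress$(i)$ and, if that returns true, contractParent$(parent,i,hashcode(k),lev-W)$, and returns $sn.v$. toCompressed$(cn)$: if $cn$ has exactly one entry and it is a tomb-inode, return its tombed snode; otherwise drop null-inode entries and replace every tomb-inode entry by an untombed copy of its snode, returning the resulting cnode if it has an entry and $null$ otherwise. toWeakTombed$(cn)$: drop null-inode entries; if more than one entry remains return $cn$ itself; if exactly one remains and it is a singleton return a tombed snode with its key and value; if exactly one remains otherwise return the one-entry cnode; if none remain return $null$. clean$(i)$: read $m=i.main$; if it is a cnode, CAS $i.main$ from $m$ to toCompressed$(m)$. tombCompress$(i)$: read $m=i.main$; if not a cnode return false; let $w=$toWeakTombed$(m)$; if $w=m$ return false; CAS $i.main$ from $m$ to $w$; on success return true iff $w$ is $null$ or a tombed snode; on failure repeat. contractParent$(parent,i,hc,lev)$: read $m=i.main$ and $pm=parent.main$; if $pm$ is a cnode $cn$ whose entry for hashcode chunk at $lev$ exists and equals $i$: if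 $m=null$ CAS $parent.main$ from $cn$ to $cn$ without that entry; if $m$ is a tombed snode CAS $parent.main$ from $cn$ to $cn$ with the entry replaced by an untombed copy; on CAS failure repeat contractParent; otherwise return. Memory is garbage-collected and all new nodes are freshly allocated. Definitions. $holds(in_{l,p},k)$ iff $in.main$ is an snode with key $k$; $holds(cn_{l,p},k)$ iff $cn.sub(k)$ is an snode with key $k$; $hasKey(cn_{l,p},k)$ iff $holds(cn,k)$ or ($cn.sub(k)$ is an inode $in_{l+W,p\cdot m(l,k)}$ and $hasKey(in,k)$); $hasKey(in_{l,p},k)$ iff $holds(in,k)$ or ($in.main$ is a cnode $cn_{l,p}$ and $hasKey(cn,k)$). Invariants: INV1: for every inode $in_{l,p}$, $in.main$ is $null$, a cnode $cn_{l,p}$, or a tombed snode. INV2: for every cnode, $\#(bmp)$ equals the array length. INV3: $cn_{l,p}.flg(r)$ iff $cn_{l,p}.arr(r)$ is an snode or an inode $in_{l+W,p\cdot r}$. INV4: if $cn_{l,p}.arr(r)$ is an snode $sn$ then $hashcode(sn.k)$ has prefix $p\cdot r$. INV5: if $in_{l,p}.main$ is a tombed snode $sn\dagger$ then $hashcode(sn.k)$ has prefix $p$. A state (the configuration of nodes reachable from $root$) is valid iff INV1–INV5 hold. An abstract set is a set $\mathbb{A}$ of keys; a state is consistent with $\mathbb{A}$ iff for all keys $k$, $k\in\mathbb{A}\Leftrightarrow hasKey(root,k)$ (with $hasKey$ false for all $k$ when $root=null$).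
   Formalization: cn.arr(r) is taken to be undefined when the flag of r is unset; with the raw index formula INV3 fails already for bmp = 10 (binary) with one snode, where arr(0) is an snode although flg(0) is false. *)

theory Defs
  imports Main
begin

unbundle bit_operations_syntax

section \<open>Nodes and the shared store\<close>

type_synonym iref = nat
type_synonym cref = nat

text \<open>Snodes are immutable and the algorithm never compares them for identity, so they are
  values. Cnodes are immutable too, but they are the expected values of CAS instructions, so they
  have an identity (a reference).\<close>

datatype ('k, 'v) snode = SNode (key: 'k) (val: 'v) (tomb: bool)

datatype ('k, 'v) branch = INode iref | Leaf "('k, 'v) snode"

datatype ('k, 'v) cnode = CNode (bmp: nat) (array: "('k, 'v) branch list")

datatype ('k, 'v) main = Null | CNodeMain cref | SNodeMain "('k, 'v) snode"

text \<open>The partial maps record all nodes allocated so far. References are never reused, which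
  renders garbage collection together with fresh allocation.\<close>

record ('k, 'v) store =
  root :: "iref option"
  inodes :: "iref \<rightharpoonup> ('k, 'v) main"
  cnodes :: "cref \<rightharpoonup> ('k, 'v) cnode"

definition new_cnode ::
  "('k, 'v) store \<Rightarrow> ('k, 'v) cnode \<Rightarrow> ('k, 'v) store \<Rightarrow> cref \<Rightarrow> bool" where
  "new_cnode s cn s' c \<longleftrightarrow>
     c \<notin> dom (cnodes s) \<and> s' = s\<lparr>cnodes := (cnodes s)(c \<mapsto> cn)\<rparr>"

definition new_inode ::
  "('k, 'v) store \<Rightarrow> ('k, 'v) main \<Rightarrow> ('k, 'v) store \<Rightarrow> iref \<Rightarrow> bool" where
  "new_inode s mn s' i \<longleftrightarrow>
     i \<notin> dom (inodes s) \<and> s' = s\<lparr>inodes := (inodes s)(i \<mapsto> mn)\<rparr>"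

definition write_main :: "('k, 'v) store \<Rightarrow> iref \<Rightarrow> ('k, 'v) main \<Rightarrow> ('k, 'v) store" where
  "write_main s i mn = s\<lparr>inodes := (inodes s)(i \<mapsto> mn)\<rparr>"

text \<open>A value about to be written into the main field of an inode, before allocation.\<close>

datatype ('k, 'v) fresh = NewNull | NewSNode "('k, 'v) snode" | NewCNode "('k, 'v) cnode"

inductive alloc_main ::
  "('k, 'v) store \<Rightarrow> ('k, 'v) fresh \<Rightarrow> ('k, 'v) store \<Rightarrow> ('k, 'v) main \<Rightarrow> bool" where
  "alloc_main s NewNull s Null"
| "alloc_main s (NewSNode sn) s (SNodeMain sn)"
| "new_cnode s cn s' c \<Longrightarrow> alloc_main s (NewCNode cn) s' (CNodeMain c)"


section \<open>Operations on cnodes\<close>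

definition bitcount :: "nat \<Rightarrow> nat" where
  "bitcount n = card {j. bit n j}"

definition flg :: "('k, 'v) cnode \<Rightarrow> nat \<Rightarrow> bool" where
  "flg cn r \<longleftrightarrow> bit (bmp cn) r"

definition pos :: "('k, 'v) cnode \<Rightarrow> nat \<Rightarrow> nat" where
  "pos cn r = bitcount ((push_bit r 1 - 1) AND bmp cn)"

text \<open>The index \<open>pos cn r\<close> belongs to \<open>r\<close> only if the flag of \<open>r\<close> is set; otherwise it
  is the index of the next larger flagged position. Hence \<open>arr\<close> is undefined for unset flags
  (and for indices outside of the array).\<close>

definition arr :: "('k, 'v) cnode \<Rightarrow> nat \<Rightarrow> ('k, 'v) branch option" where
  "arr cn r = (if flg cn r \<and> pos cn r < length (array cn) then Some (array cn ! pos cn r) else None)"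

definition inserted :: "('k, 'v) cnode \<Rightarrow> nat \<Rightarrow> ('k, 'v) branch \<Rightarrow> ('k, 'v) cnode" where
  "inserted cn r b =
     CNode (set_bit r (bmp cn)) (take (pos cn r) (array cn) @ b # drop (pos cn r) (array cn))"

definition updated :: "('k, 'v) cnode \<Rightarrow> nat \<Rightarrow> ('k, 'v) branch \<Rightarrow> ('k, 'v) cnode" where
  "updated cn r b = CNode (bmp cn) ((array cn)[pos cn r := b])"

definition removed :: "('k, 'v) cnode \<Rightarrow> nat \<Rightarrow> ('k, 'v) cnode" where
  "removed cn r =
     CNode (unset_bit r (bmp cn)) (take (pos cn r) (array cn) @ drop (Suc (pos cn r)) (array cn))"

text \<open>Transforms all entries; an entry mapped to \<open>None\<close> is dropped and its flag is cleared.\<close>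

definition map_entries ::
  "(('k, 'v) branch \<Rightarrow> ('k, 'v) branch option) \<Rightarrow> ('k, 'v) cnode \<Rightarrow> ('k, 'v) cnode" where
  "map_entries f cn =
     CNode (\<Sum>r | flg cn r \<and> f (array cn ! pos cn r) \<noteq> None. 2 ^ r) (List.map_filter f (array cn))"

text \<open>Compression inspects the main fields of the child inodes, which are mutable. The following
  functions take the values that were read from these fields.\<close>

type_synonym ('k, 'v) obs = "iref \<rightharpoonup> ('k, 'v) main"

definition null_inode :: "('k, 'v) obs \<Rightarrow> ('k, 'v) branch \<Rightarrow> bool" where
  "null_inode obs b \<longleftrightarrow> (\<exists>i. b = INode i \<and> obs i = Some Null)"

definition resurrect :: "('k, 'v) obs \<Rightarrow> ('k, 'v) branch \<Rightarrow> ('k, 'v) branch" where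
  "resurrect obs b = (case b of
       INode i \<Rightarrow> (case obs i of
           Some (SNodeMain (SNode k v True)) \<Rightarrow> Leaf (SNode k v False)
         | _ \<Rightarrow> b)
     | Leaf _ \<Rightarrow> b)"

text \<open>\<open>toCompressed\<close> without its initial test for a single tomb-inode entry.\<close>

definition compressed :: "('k, 'v) obs \<Rightarrow> ('k, 'v) cnode \<Rightarrow> ('k, 'v) fresh" where
  "compressed obs cn =
     (let cn' = map_entries (\<lambda>b. if null_inode obs b then None else Some (resurrect obs b)) cn
      in if array cn' = [] then NewNull else NewCNode cn')"

text \<open>The result \<open>None\<close> stands for the given cnode itself.\<close>

definition toWeakTombed :: "('k, 'v) obs \<Rightarrow> ('k, 'v) cnode \<Rightarrow> ('k, 'v) fresh option" where
  "toWeakTombed obs cn =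
     (let cn' = map_entries (\<lambda>b. if null_inode obs b then None else Some b) cn
      in case array cn' of
           [] \<Rightarrow> Some NewNull
         | [b] \<Rightarrow> (case resurrect obs b of
               Leaf sn \<Rightarrow> Some (NewSNode (SNode (key sn) (val sn) True))
             | INode _ \<Rightarrow> Some (NewCNode cn'))
         | _ \<Rightarrow> None)"


section \<open>Operations, program counters, events\<close>

datatype ('k, 'v) operation = Insert 'k 'v | Lookup 'k | Remove 'k

fun op_key :: "('k, 'v) operation \<Rightarrow> 'k" where
  "op_key (Insert k v) = k"
| "op_key (Lookup k) = k"
| "op_key (Remove k) = k"

datatype 'v result = Inserted | NotFound | Found 'v

text \<open>Each constructor denotes the point just before the indicated shared memory access (or just
  before returning). In the constructors with prefix \<open>Tomb\<close> and \<open>Contract\<close>, which belong to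
  the clean-up after a removal, the first arguments are the inode, its parent, the level of the
  inode, and the value to be returned in the end.\<close>

datatype ('k, 'v) pc =
    ReadRoot
  | TestRoot iref
  | CasRoot "iref option"
  | Visit iref nat "iref option"
  | InsertCas iref cref nat
  | RemoveCas iref cref nat "iref option"
  | Clean iref
  | CleanTest iref cref
  | CleanScan iref cref "('k, 'v) obs"
  | CleanCas iref cref "('k, 'v) fresh"
  | TombCompress iref iref nat 'v
  | TombScan iref iref nat 'v cref "('k, 'v) obs"
  | TombCas iref iref nat 'v cref "('k, 'v) fresh"
  | Contract iref iref nat 'v
  | ContractParent iref iref nat 'v "('k, 'v) main"
  | ContractCas iref iref nat 'v "('k, 'v) main" cref
  | Return "'v result"

datatype ('k, 'v) thread = Idle | Busy "('k, 'v) operation" "('k, 'v) pc"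

record ('t, 'k, 'v) config =
  mem :: "('k, 'v) store"
  threads :: "'t \<Rightarrow> ('k, 'v) thread"

datatype ('k, 'v) event = Invoke "('k, 'v) operation" | Internal | Respond "'v result"

definition initial :: "('t, 'k, 'v) config" where
  "initial = \<lparr>mem = \<lparr>root = None, inodes = Map.empty, cnodes = Map.empty\<rparr>, threads = (\<lambda>_. Idle)\<rparr>"

context
  fixes W :: nat and hashcode :: "'k \<Rightarrow> nat"
begin

definition chunk :: "nat \<Rightarrow> 'k \<Rightarrow> nat" where
  "chunk l k = drop_bit l (hashcode k) mod 2 ^ W"

definition sub :: "('k, 'v) cnode \<Rightarrow> nat \<Rightarrow> 'k \<Rightarrow> ('k, 'v) branch option" where
  "sub cn l k = (if flg cn (chunk l k) then arr cn (chunk l k) else None)"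


section \<open>The algorithm\<close>

text \<open>\<open>dual s l x y s' c\<close>: starting in \<open>s\<close>, a new cnode \<open>c\<close> at level \<open>l\<close> is
  allocated that contains \<open>x\<close> and \<open>y\<close>, together with the deeper nodes needed while the
  chunks coincide. If the hashcodes coincide, the construction does not terminate, and
  there is no result.\<close>

inductive dual ::
  "('k, 'v) store \<Rightarrow> nat \<Rightarrow> ('k, 'v) snode \<Rightarrow> ('k, 'v) snode \<Rightarrow> ('k, 'v) store \<Rightarrow> cref \<Rightarrow> bool" where
  distinct:
    "\<lbrakk>rx = chunk l (key x); ry = chunk l (key y); rx \<noteq> ry;
      new_cnode s (CNode (2 ^ rx + 2 ^ ry) (if rx < ry then [Leaf x, Leaf y] else [Leaf y, Leaf x])) s' c\<rbrakk>
     \<Longrightarrow> dual s l x y s' c"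
| equal:
    "\<lbrakk>chunk l (key x) = chunk l (key y);
      dual s (l + W) x y s1 c1; new_inode s1 (CNodeMain c1) s2 i;
      new_cnode s2 (CNode (2 ^ chunk l (key x)) [INode i]) s' c\<rbrakk>
     \<Longrightarrow> dual s l x y s' c"

text \<open>\<open>insert_copy s l k v cn s' cn'\<close>: the updated copy \<open>cn'\<close> of the cnode \<open>cn\<close> at level
  \<open>l\<close> which \<open>iinsert\<close> attempts to install; \<open>s'\<close> extends \<open>s\<close> by the new nodes below \<open>cn'\<close>.\<close>

inductive insert_copy ::
  "('k, 'v) store \<Rightarrow> nat \<Rightarrow> 'k \<Rightarrow> 'v \<Rightarrow> ('k, 'v) cnode \<Rightarrow> ('k, 'v) store \<Rightarrow> ('k, 'v) cnode \<Rightarrow> bool" where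
  unset:
    "\<not> flg cn (chunk l k)
     \<Longrightarrow> insert_copy s l k v cn s (inserted cn (chunk l k) (Leaf (SNode k v False)))"
| same_key:
    "\<lbrakk>sub cn l k = Some (Leaf sn); \<not> tomb sn; key sn = k\<rbrakk>
     \<Longrightarrow> insert_copy s l k v cn s (updated cn (chunk l k) (Leaf (SNode k v False)))"
| other_key:
    "\<lbrakk>sub cn l k = Some (Leaf sn); \<not> tomb sn; key sn \<noteq> k;
      dual s (l + W) sn (SNode k v False) s1 c; new_inode s1 (CNodeMain c) s' i\<rbrakk>
     \<Longrightarrow> insert_copy s l k v cn s' (updated cn (chunk l k) (INode i))"

text \<open>\<open>exec x s p s' p'\<close>: a single internal step of a thread executing the operation \<open>x\<close>,
  changing the store from \<open>s\<close> to \<open>s'\<close> and the program counter from \<open>p\<close> to \<open>p'\<close>. Every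
  step makes at most one access (read or CAS) to a mutable location. Private allocations are
  performed together with the CAS that publishes the new nodes. Restarting an operation means
  continuing at \<open>ReadRoot\<close>.\<close>

inductive exec ::
  "('k, 'v) operation \<Rightarrow> ('k, 'v) store \<Rightarrow> ('k, 'v) pc \<Rightarrow> ('k, 'v) store \<Rightarrow> ('k, 'v) pc \<Rightarrow> bool"
  for x :: "('k, 'v) operation" and s :: "('k, 'v) store" where
  \<comment> \<open>top-level operations\<close>
  root_null_insert:
    "\<lbrakk>root s = None; x = Insert k v\<rbrakk> \<Longrightarrow> exec x s ReadRoot s (CasRoot None)"
| root_null_other:
    "\<lbrakk>root s = None; \<forall>k v. x \<noteq> Insert k v\<rbrakk> \<Longrightarrow> exec x s ReadRoot s (Return NotFound)"
| root_inode:
    "root s = Some r \<Longrightarrow> exec x s ReadRoot s (TestRoot r)"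
| root_null_inode:
    "inodes s r = Some Null \<Longrightarrow> exec x s (TestRoot r) s (CasRoot (Some r))"
| root_other_inode:
    "\<lbrakk>inodes s r = Some mn; mn \<noteq> Null\<rbrakk> \<Longrightarrow> exec x s (TestRoot r) s (Visit r 0 None)"
| cas_root_fail:
    "root s \<noteq> ro \<Longrightarrow> exec x s (CasRoot ro) s ReadRoot"
| cas_root_insert:
    "\<lbrakk>root s = ro; x = Insert k v;
      new_cnode s (CNode (2 ^ chunk 0 k) [Leaf (SNode k v False)]) s1 c;
      new_inode s1 (CNodeMain c) s2 i\<rbrakk>
     \<Longrightarrow> exec x s (CasRoot ro) (s2\<lparr>root := Some i\<rparr>) (Return Inserted)"
| cas_root_other:
    "\<lbrakk>root s = ro; \<forall>k v. x \<noteq> Insert k v\<rbrakk>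
     \<Longrightarrow> exec x s (CasRoot ro) (s\<lparr>root := None\<rparr>) ReadRoot"

  \<comment> \<open>\<open>iinsert\<close>, \<open>ilookup\<close>, \<open>iremove\<close>\<close>
| visit_nonlive_root:
    "\<lbrakk>inodes s i = Some mn; mn = Null \<or> (\<exists>sn. mn = SNodeMain sn \<and> tomb sn)\<rbrakk>
     \<Longrightarrow> exec x s (Visit i l None) s ReadRoot"
| visit_nonlive:
    "\<lbrakk>inodes s i = Some mn; mn = Null \<or> (\<exists>sn. mn = SNodeMain sn \<and> tomb sn)\<rbrakk>
     \<Longrightarrow> exec x s (Visit i l (Some p)) s (Clean p)"
| visit_inode:
    "\<lbrakk>inodes s i = Some (CNodeMain c); cnodes s c = Some cn;
      sub cn l (op_key x) = Some (INode j)\<rbrakk>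
     \<Longrightarrow> exec x s (Visit i l po) s (Visit j (l + W) (Some i))"
| visit_insert:
    "\<lbrakk>inodes s i = Some (CNodeMain c); cnodes s c = Some cn; x = Insert k v;
      \<not> flg cn (chunk l k) \<or> (\<exists>sn. sub cn l k = Some (Leaf sn) \<and> \<not> tomb sn)\<rbrakk>
     \<Longrightarrow> exec x s (Visit i l po) s (InsertCas i c l)"
| visit_unset:
    "\<lbrakk>inodes s i = Some (CNodeMain c); cnodes s c = Some cn; \<forall>k v. x \<noteq> Insert k v;
      \<not> flg cn (chunk l (op_key x))\<rbrakk>
     \<Longrightarrow> exec x s (Visit i l po) s (Return NotFound)"
| visit_other_key:
    "\<lbrakk>inodes s i = Some (CNodeMain c); cnodes s c = Some cn; \<forall>k v. x \<noteq> Insert k v;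
      sub cn l (op_key x) = Some (Leaf sn); \<not> tomb sn; key sn \<noteq> op_key x\<rbrakk>
     \<Longrightarrow> exec x s (Visit i l po) s (Return NotFound)"
| visit_lookup:
    "\<lbrakk>inodes s i = Some (CNodeMain c); cnodes s c = Some cn; x = Lookup k;
      sub cn l k = Some (Leaf sn); \<not> tomb sn; key sn = k\<rbrakk>
     \<Longrightarrow> exec x s (Visit i l po) s (Return (Found (val sn)))"
| visit_remove:
    "\<lbrakk>inodes s i = Some (CNodeMain c); cnodes s c = Some cn; x = Remove k;
      sub cn l k = Some (Leaf sn); \<not> tomb sn; key sn = k\<rbrakk>
     \<Longrightarrow> exec x s (Visit i l po) s (RemoveCas i c l po)"
| insert_fail:
    "inodes s i \<noteq> Some (CNodeMain c) \<Longrightarrow> exec x s (InsertCas i c l) s ReadRoot"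
| insert_success:
    "\<lbrakk>inodes s i = Some (CNodeMain c); cnodes s c = Some cn; x = Insert k v;
      insert_copy s l k v cn s1 cn'; new_cnode s1 cn' s2 c'\<rbrakk>
     \<Longrightarrow> exec x s (InsertCas i c l) (write_main s2 i (CNodeMain c')) (Return Inserted)"
| remove_fail:
    "inodes s i \<noteq> Some (CNodeMain c) \<Longrightarrow> exec x s (RemoveCas i c l po) s ReadRoot"
| remove_success:
    "\<lbrakk>inodes s i = Some (CNodeMain c); cnodes s c = Some cn; x = Remove k;
      sub cn l k = Some (Leaf sn);
      alloc_main s (if length (array cn) = 1 then NewNull else NewCNode (removed cn (chunk l k))) s1 mn\<rbrakk>
     \<Longrightarrow> exec x s (RemoveCas i c l po) (write_main s1 i mn)
           (case po of None \<Rightarrow> Return (Found (val sn)) | Some p \<Rightarrow> TombCompress i p l (val sn))"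

  \<comment> \<open>\<open>clean\<close>, always followed by a restart\<close>
| clean_other:
    "\<lbrakk>inodes s i = Some mn; \<forall>c. mn \<noteq> CNodeMain c\<rbrakk> \<Longrightarrow> exec x s (Clean i) s ReadRoot"
| clean_cnode:
    "inodes s i = Some (CNodeMain c) \<Longrightarrow> exec x s (Clean i) s (CleanTest i c)"
| clean_single_tomb:
    "\<lbrakk>cnodes s c = Some cn; array cn = [INode j]; inodes s j = Some (SNodeMain sn); tomb sn\<rbrakk>
     \<Longrightarrow> exec x s (CleanTest i c) s (CleanCas i c (NewSNode sn))"
| clean_not_single_tomb:
    "\<lbrakk>cnodes s c = Some cn;
      \<nexists>j sn. array cn = [INode j] \<and> inodes s j = Some (SNodeMain sn) \<and> tomb sn\<rbrakk>
     \<Longrightarrow> exec x s (CleanTest i c) s (CleanScan i c Map.empty)"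
| clean_scan:
    "\<lbrakk>cnodes s c = Some cn; INode j \<in> set (array cn); j \<notin> dom obs; inodes s j = Some mn\<rbrakk>
     \<Longrightarrow> exec x s (CleanScan i c obs) s (CleanScan i c (obs(j \<mapsto> mn)))"
| clean_scan_done:
    "\<lbrakk>cnodes s c = Some cn; \<forall>j. INode j \<in> set (array cn) \<longrightarrow> j \<in> dom obs\<rbrakk>
     \<Longrightarrow> exec x s (CleanScan i c obs) s (CleanCas i c (compressed obs cn))"
| clean_fail:
    "inodes s i \<noteq> Some (CNodeMain c) \<Longrightarrow> exec x s (CleanCas i c f) s ReadRoot"
| clean_success:
    "\<lbrakk>inodes s i = Some (CNodeMain c); alloc_main s f s1 mn\<rbrakk>
     \<Longrightarrow> exec x s (CleanCas i c f) (write_main s1 i mn) ReadRoot"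

  \<comment> \<open>\<open>tombCompress\<close>\<close>
| tomb_other:
    "\<lbrakk>inodes s i = Some mn; \<forall>c. mn \<noteq> CNodeMain c\<rbrakk>
     \<Longrightarrow> exec x s (TombCompress i p l w) s (Return (Found w))"
| tomb_cnode:
    "inodes s i = Some (CNodeMain c)
     \<Longrightarrow> exec x s (TombCompress i p l w) s (TombScan i p l w c Map.empty)"
| tomb_scan:
    "\<lbrakk>cnodes s c = Some cn; INode j \<in> set (array cn); j \<notin> dom obs; inodes s j = Some mn\<rbrakk>
     \<Longrightarrow> exec x s (TombScan i p l w c obs) s (TombScan i p l w c (obs(j \<mapsto> mn)))"
| tomb_scan_unchanged:
    "\<lbrakk>cnodes s c = Some cn; \<forall>j. INode j \<in> set (array cn) \<longrightarrow> j \<in> dom obs;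
      toWeakTombed obs cn = None\<rbrakk>
     \<Longrightarrow> exec x s (TombScan i p l w c obs) s (Return (Found w))"
| tomb_scan_changed:
    "\<lbrakk>cnodes s c = Some cn; \<forall>j. INode j \<in> set (array cn) \<longrightarrow> j \<in> dom obs;
      toWeakTombed obs cn = Some f\<rbrakk>
     \<Longrightarrow> exec x s (TombScan i p l w c obs) s (TombCas i p l w c f)"
| tomb_fail:
    "inodes s i \<noteq> Some (CNodeMain c)
     \<Longrightarrow> exec x s (TombCas i p l w c f) s (TombCompress i p l w)"
| tomb_success:
    "\<lbrakk>inodes s i = Some (CNodeMain c); alloc_main s f s1 mn\<rbrakk>
     \<Longrightarrow> exec x s (TombCas i p l w c f) (write_main s1 i mn)
           (case f of NewCNode _ \<Rightarrow> Return (Found w) | _ \<Rightarrow> Contract i p l w)"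

  \<comment> \<open>\<open>contractParent\<close>, called with the level \<open>l - W\<close> of the parent\<close>
| contract_read:
    "inodes s i = Some mn \<Longrightarrow> exec x s (Contract i p l w) s (ContractParent i p l w mn)"
| contract_go:
    "\<lbrakk>inodes s p = Some (CNodeMain c); cnodes s c = Some cn;
      sub cn (l - W) (op_key x) = Some (INode i);
      mn = Null \<or> (\<exists>sn. mn = SNodeMain sn \<and> tomb sn)\<rbrakk>
     \<Longrightarrow> exec x s (ContractParent i p l w mn) s (ContractCas i p l w mn c)"
| contract_stop:
    "\<not> (\<exists>c cn. inodes s p = Some (CNodeMain c) \<and> cnodes s c = Some cn \<and>
         sub cn (l - W) (op_key x) = Some (INode i) \<and>
         (mn = Null \<or> (\<exists>sn. mn = SNodeMain sn \<and> tomb sn)))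
     \<Longrightarrow> exec x s (ContractParent i p l w mn) s (Return (Found w))"
| contract_fail:
    "inodes s p \<noteq> Some (CNodeMain c)
     \<Longrightarrow> exec x s (ContractCas i p l w mn c) s (Contract i p l w)"
| contract_null:
    "\<lbrakk>inodes s p = Some (CNodeMain c); cnodes s c = Some cn;
      new_cnode s (removed cn (chunk (l - W) (op_key x))) s1 c'\<rbrakk>
     \<Longrightarrow> exec x s (ContractCas i p l w Null c) (write_main s1 p (CNodeMain c')) (Return (Found w))"
| contract_tomb:
    "\<lbrakk>inodes s p = Some (CNodeMain c); cnodes s c = Some cn;
      new_cnode s (updated cn (chunk (l - W) (op_key x)) (Leaf (SNode (key sn) (val sn) False))) s1 c'\<rbrakk>
     \<Longrightarrow> exec x s (ContractCas i p l w (SNodeMain sn) c) (write_main s1 p (CNodeMain c'))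
           (Return (Found w))"

inductive step ::
  "('t, 'k, 'v) config \<Rightarrow> 't \<Rightarrow> ('k, 'v) event \<Rightarrow> ('t, 'k, 'v) config \<Rightarrow> bool" where
  invoke:
    "threads C t = Idle
     \<Longrightarrow> step C t (Invoke x) (C\<lparr>threads := (threads C)(t := Busy x ReadRoot)\<rparr>)"
| internal:
    "\<lbrakk>threads C t = Busy x p; exec x (mem C) p s' p'\<rbrakk>
     \<Longrightarrow> step C t Internal (C\<lparr>mem := s', threads := (threads C)(t := Busy x p')\<rparr>)"
| respond:
    "threads C t = Busy x (Return res)
     \<Longrightarrow> step C t (Respond res) (C\<lparr>threads := (threads C)(t := Idle)\<rparr>)"

text \<open>An execution is a sequence of configurations with the events between them. At times with
  event \<open>None\<close> nothing happens, so finite executions are included.\<close>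

definition execution ::
  "(nat \<Rightarrow> ('t, 'k, 'v) config) \<Rightarrow> (nat \<Rightarrow> ('t \<times> ('k, 'v) event) option) \<Rightarrow> bool" where
  "execution \<sigma> ev \<longleftrightarrow> \<sigma> 0 = initial \<and>
     (\<forall>n. case ev n of
            None \<Rightarrow> \<sigma> (Suc n) = \<sigma> n
          | Some (t, e) \<Rightarrow> step (\<sigma> n) t e (\<sigma> (Suc n)))"


section \<open>Valid states\<close>

text \<open>Nodes reachable from the root, with their level and their hashcode prefix. A prefix is a
  list of chunks; the chunk for level 0 comes first.\<close>

inductive inode_at :: "('k, 'v) store \<Rightarrow> iref \<Rightarrow> nat \<Rightarrow> nat list \<Rightarrow> bool"
  and cnode_at :: "('k, 'v) store \<Rightarrow> cref \<Rightarrow> nat \<Rightarrow> nat list \<Rightarrow> bool"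
  for s :: "('k, 'v) store" where
  "root s = Some i \<Longrightarrow> inode_at s i 0 []"
| "\<lbrakk>inode_at s i l p; inodes s i = Some (CNodeMain c); c \<in> dom (cnodes s)\<rbrakk>
   \<Longrightarrow> cnode_at s c l p"
| "\<lbrakk>cnode_at s c l p; cnodes s c = Some cn; r < 2 ^ W; arr cn r = Some (INode i)\<rbrakk>
   \<Longrightarrow> inode_at s i (l + W) (p @ [r])"

definition has_prefix :: "'k \<Rightarrow> nat list \<Rightarrow> bool" where
  "has_prefix k p \<longleftrightarrow> (\<forall>j < length p. p ! j = chunk (j * W) k)"

definition INV1 :: "('k, 'v) store \<Rightarrow> bool" where
  "INV1 s \<longleftrightarrow> (\<forall>i l p. inode_at s i l p \<longrightarrow>
     inodes s i = Some Null \<or>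
     (\<exists>c. inodes s i = Some (CNodeMain c) \<and> cnode_at s c l p) \<or>
     (\<exists>sn. inodes s i = Some (SNodeMain sn) \<and> tomb sn))"

definition INV2 :: "('k, 'v) store \<Rightarrow> bool" where
  "INV2 s \<longleftrightarrow> (\<forall>c l p cn. cnode_at s c l p \<and> cnodes s c = Some cn \<longrightarrow>
     bitcount (bmp cn) = length (array cn))"

definition INV3 :: "('k, 'v) store \<Rightarrow> bool" where
  "INV3 s \<longleftrightarrow> (\<forall>c l p cn. cnode_at s c l p \<and> cnodes s c = Some cn \<longrightarrow>
     (\<forall>r < 2 ^ W. flg cn r \<longleftrightarrow>
        (\<exists>sn. arr cn r = Some (Leaf sn)) \<or>
        (\<exists>i. arr cn r = Some (INode i) \<and> inode_at s i (l + W) (p @ [r]))))"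

definition INV4 :: "('k, 'v) store \<Rightarrow> bool" where
  "INV4 s \<longleftrightarrow> (\<forall>c l p cn r sn. cnode_at s c l p \<and> cnodes s c = Some cn \<and> r < 2 ^ W \<and>
     arr cn r = Some (Leaf sn) \<longrightarrow> has_prefix (key sn) (p @ [r]))"

definition INV5 :: "('k, 'v) store \<Rightarrow> bool" where
  "INV5 s \<longleftrightarrow> (\<forall>i l p sn. inode_at s i l p \<and> inodes s i = Some (SNodeMain sn) \<and> tomb sn \<longrightarrow>
     has_prefix (key sn) p)"

definition valid :: "('k, 'v) store \<Rightarrow> bool" where
  "valid s \<longleftrightarrow> INV1 s \<and> INV2 s \<and> INV3 s \<and> INV4 s \<and> INV5 s"


section \<open>Consistency with an abstract set\<close>

definition holds_inode :: "('k, 'v) store \<Rightarrow> iref \<Rightarrow> 'k \<Rightarrow> bool" where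
  "holds_inode s i k \<longleftrightarrow> (\<exists>sn. inodes s i = Some (SNodeMain sn) \<and> key sn = k)"

definition holds_cnode :: "('k, 'v) cnode \<Rightarrow> nat \<Rightarrow> 'k \<Rightarrow> bool" where
  "holds_cnode cn l k \<longleftrightarrow> (\<exists>sn. sub cn l k = Some (Leaf sn) \<and> key sn = k)"

text \<open>The number is the level of the node.\<close>

inductive hasKey_inode :: "('k, 'v) store \<Rightarrow> iref \<Rightarrow> nat \<Rightarrow> 'k \<Rightarrow> bool"
  and hasKey_cnode :: "('k, 'v) store \<Rightarrow> cref \<Rightarrow> nat \<Rightarrow> 'k \<Rightarrow> bool"
  for s :: "('k, 'v) store" where
  "holds_inode s i k \<Longrightarrow> hasKey_inode s i l k"
| "\<lbrakk>inodes s i = Some (CNodeMain c); hasKey_cnode s c l k\<rbrakk> \<Longrightarrow> hasKey_inode s i l k"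
| "\<lbrakk>cnodes s c = Some cn; holds_cnode cn l k\<rbrakk> \<Longrightarrow> hasKey_cnode s c l k"
| "\<lbrakk>cnodes s c = Some cn; sub cn l k = Some (INode i); hasKey_inode s i (l + W) k\<rbrakk>
   \<Longrightarrow> hasKey_cnode s c l k"

definition consistent :: "('k, 'v) store \<Rightarrow> 'k set \<Rightarrow> bool" where
  "consistent s A \<longleftrightarrow> (\<forall>k. k \<in> A \<longleftrightarrow> (\<exists>i. root s = Some i \<and> hasKey_inode s i 0 k))"

fun abstract_op :: "('k, 'v) operation \<Rightarrow> 'k set \<Rightarrow> 'k set" where
  "abstract_op (Insert k v) A = A \<union> {k}"
| "abstract_op (Lookup k) A = A"
| "abstract_op (Remove k) A = A - {k}"

text \<open>Times of the internal steps of the operation invoked by thread \<open>t\<close> at time \<open>a\<close>.\<close>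

definition steps_of :: "(nat \<Rightarrow> ('t \<times> ('k, 'v) event) option) \<Rightarrow> 't \<Rightarrow> nat \<Rightarrow> nat set" where
  "steps_of ev t a =
     {n. a < n \<and> ev n = Some (t, Internal) \<and> (\<forall>j res. a < j \<and> j < n \<longrightarrow> ev j \<noteq> Some (t, Respond res))}"

text \<open>The operation invoked by thread \<open>t\<close> at time \<open>a\<close> returns \<open>res\<close> at time \<open>b\<close>.\<close>

definition returns ::
  "(nat \<Rightarrow> ('t \<times> ('k, 'v) event) option) \<Rightarrow> 't \<Rightarrow> nat \<Rightarrow> nat \<Rightarrow> 'v result \<Rightarrow> bool" where
  "returns ev t a b res \<longleftrightarrow>
     a < b \<and> ev b = Some (t, Respond res) \<and> (\<forall>j res'. a < j \<and> j < b \<longrightarrow> ev j \<noteq> Some (t, Respond res'))"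

text \<open>\<open>L\<close> is the set of times at which operations take effect: every operation takes effect at
  most once, by one of its own steps, and exactly once if it returns. All other steps of the
  execution preserve the abstract set.\<close>

definition operations_consistent ::
  "(nat \<Rightarrow> ('t, 'k, 'v) config) \<Rightarrow> (nat \<Rightarrow> ('t \<times> ('k, 'v) event) option) \<Rightarrow> bool" where
  "operations_consistent \<sigma> ev \<longleftrightarrow> (\<exists>L.
     (\<forall>n. n \<notin> L \<longrightarrow>
        (\<forall>A. consistent (mem (\<sigma> n)) A \<longrightarrow> consistent (mem (\<sigma> (Suc n))) A)) \<and>
     (\<forall>n \<in> L. \<exists>t a x. ev a = Some (t, Invoke x) \<and> n \<in> steps_of ev t a \<and>
        (\<forall>A. consistent (mem (\<sigma> n)) A \<longrightarrow> consistent (mem (\<sigma> (Suc n))) (abstract_op x A))) \<and>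
     (\<forall>t a x. ev a = Some (t, Invoke x) \<longrightarrow>
        (\<forall>n \<in> L \<inter> steps_of ev t a. \<forall>n' \<in> L \<inter> steps_of ev t a. n = n')) \<and>
     (\<forall>t a x b res. ev a = Some (t, Invoke x) \<and> returns ev t a b res \<longrightarrow>
        (\<exists>n \<in> L \<inter> steps_of ev t a. n < b \<and>
           (\<forall>k A. x = Lookup k \<and> consistent (mem (\<sigma> n)) A \<longrightarrow> ((\<exists>v. res = Found v) \<longleftrightarrow> k \<in> A)))))"

end

end

theory Submission
  imports Defs
begin

text \<open>Every inode keeps the prefix at which it was created; a ghost function records these
  prefixes, also for nodes that are no longer reachable, so that well-formedness of the store is a
  local condition. The main field of an inode changes only while it is a cnode, so nonlive inodes
  are final: outdated observations made by compression remain true where they matter. Every live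
  inode stays linked to a live parent, since a CAS drops only leaves and nonlive inodes. Hence a
  live inode lies on the search path from the root for all keys with its prefix, and reading or
  writing it determines or changes membership of exactly these keys. An operation takes effect at
  the step that fixes its result, which is the CAS that inserts or removes the key or a read that
  settles membership.\<close>

subsection \<open>Cnodes as partial maps\<close>

text \<open>A thread keeps using inodes that others may already have cut off, so neither
  reachability nor the content of a live inode survives the steps of the others. Assertions about
  program counters are therefore built from data that no step alters, such as contents of allocated
  cnodes and ghost prefixes. A CAS on a main field turns such old data into current data: cnodes are
  immutable and their references are never reused, so if the expected reference is still in place,
  everything computed from that cnode still describes the inode. Reads can settle a result on the
  spot for a similar reason: an inode found to contain a cnode is live at that moment, hence linked,
  however outdated the path was that led to it. So every operation can be assigned one of its own
  steps, and which one is visible from its program counter alone. Cycles in the heap cause no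
  trouble, as each link lengthens the prefix by one chunk.\<close>

lemma finite_bits: "finite {j. bit (n::nat) j}"
proof -
  have "{j. bit n j} \<subseteq> {..n}"
  proof
    fix j assume "j \<in> {j. bit n j}"
    \<comment> \<open>If \<open>n < 2 ^ j\<close>, the quotient would be 0, which is even, so bit
      \<open>j\<close> would not be set.\<close>
    then have "2 ^ j \<le> n" by (auto simp: bit_iff_odd) (metis div_less even_zero not_le)
    then show "j \<in> {..n}" using less_exp[of j] by (meson atMost_iff le_trans less_imp_le)
  qed
  then show ?thesis using finite_subset by blast
qed

text \<open>Adding a power that is not yet in the sum causes no carry, so the addition is a bitwise
  OR. Compression builds its bitmap as such a sum.\<close>

lemma bit_sum_exp: "finite R \<Longrightarrow> bit (\<Sum>r\<in>R. 2 ^ r :: nat) j \<longleftrightarrow> j \<in> R"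
proof (induction R arbitrary: j rule: finite_induct)
  case (insert a R)
  have "(\<Sum>r\<in>insert a R. 2 ^ r :: nat) = 2 ^ a + (\<Sum>r\<in>R. 2 ^ r)"
    using insert.hyps by simp
  also have "\<dots> = (2 ^ a) OR (\<Sum>r\<in>R. 2 ^ r)"
    by (rule disjunctive_add) (use insert in \<open>auto simp: bit_exp_iff\<close>)
  finally show ?case using insert.IH by (auto simp: bit_or_iff bit_exp_iff)
qed simp

text \<open>The mask selects the bits below \<open>r\<close>, so \<open>pos\<close> is the rank of
  \<open>r\<close> among the flagged indices. From here on bitmaps are treated as finite sets and
  array positions as cardinalities.\<close>

lemma pos_eq: "pos cn r = card {j. j < r \<and> flg cn j}"
proof -
  have "push_bit r 1 - 1 = (mask r :: nat)" by (simp add: mask_eq_exp_minus_1 push_bit_of_1)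
  then show ?thesis by (simp add: pos_def bitcount_def bit_and_iff bit_mask_iff flg_def)
qed

lemma finite_flg: "finite {j. flg cn j}" "finite {j. flg cn j \<and> P j}" "finite {j. j < (r::nat) \<and> P j}"
  unfolding flg_def using finite_subset[OF _ finite_bits[of "bmp cn"]] by auto

definition wf_cnode :: "('k, 'v) cnode \<Rightarrow> bool" where
  "wf_cnode cn \<longleftrightarrow> bitcount (bmp cn) = length (array cn)"

lemma wf_cnode_iff: "wf_cnode cn \<longleftrightarrow> card {j. flg cn j} = length (array cn)"
  by (simp add: wf_cnode_def bitcount_def flg_def)

lemma pos_less: "flg cn r \<Longrightarrow> r < r' \<Longrightarrow> pos cn r < pos cn r'"
  unfolding pos_eq by (intro psubset_card_mono) (auto simp: finite_flg)

lemma pos_mono: "r \<le> r' \<Longrightarrow> pos cn r \<le> pos cn r'"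
  unfolding pos_eq by (intro card_mono) (auto simp: finite_flg)

lemma pos_less_length: "wf_cnode cn \<Longrightarrow> flg cn r \<Longrightarrow> pos cn r < length (array cn)"
  unfolding pos_eq wf_cnode_iff by (erule subst, intro psubset_card_mono) (auto simp: finite_flg)

lemma pos_le_length: "wf_cnode cn \<Longrightarrow> pos cn r \<le> length (array cn)"
  unfolding pos_eq wf_cnode_iff by (erule subst, intro card_mono) (auto simp: finite_flg)

lemma pos_eq_iff: "flg cn r \<Longrightarrow> flg cn r' \<Longrightarrow> pos cn r = pos cn r' \<longleftrightarrow> r = r'"
  using pos_less[of cn r r'] pos_less[of cn r' r] by (cases r r' rule: linorder_cases) auto

text \<open>The rank is strictly increasing on flagged indices, and an injection between finite sets
  of equal size is onto. So every array cell belongs to exactly one chunk.\<close>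

lemma bij_betw_pos: "wf_cnode cn \<Longrightarrow> bij_betw (pos cn) {r. flg cn r} {..<length (array cn)}"
  unfolding bij_betw_def
proof
  show inj: "inj_on (pos cn) {r. flg cn r}" by (auto simp: inj_on_def pos_eq_iff)
  assume "wf_cnode cn"
  then show "pos cn ` {r. flg cn r} = {..<length (array cn)}"
    by (intro card_subset_eq) (auto simp: pos_less_length card_image[OF inj] wf_cnode_iff)
qed

lemma arr_wf: "wf_cnode cn \<Longrightarrow> arr cn r = (if flg cn r then Some (array cn ! pos cn r) else None)"
  by (auto simp: arr_def pos_less_length)

lemma sub_eq_arr: "sub W h cn l k = arr cn (chunk W h l k)"
  by (simp add: sub_def arr_def)

text \<open>A one-element array does not tell which chunk its cell belongs to, hence the existential
  \<open>r\<close>; where the chunk matters it is recovered from the prefix of the key.\<close>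

lemma arr_singleton:
  assumes "wf_cnode cn" "array cn = [b]"
  obtains r where "arr cn = [r \<mapsto> b]"
proof -
  from assms have "card {j. flg cn j} = Suc 0" by (simp add: wf_cnode_iff)
  then obtain r where r: "{j. flg cn j} = {r}" by (metis One_nat_def card_1_singletonE)
  have "arr cn j = [r \<mapsto> b] j" for j
  proof (cases "j = r")
    case True
    then have "pos cn j < 1" using pos_less_length[OF assms(1), of j] r assms(2) by auto
    then show ?thesis using True r assms by (auto simp: arr_wf)
  qed (use r assms in \<open>auto simp: arr_wf\<close>)
  then show ?thesis using that by blast
qed

lemma arr_empty: "wf_cnode cn \<Longrightarrow> array cn = [] \<Longrightarrow> arr cn = Map.empty"
  by (rule ext) (auto simp: arr_def)

section \<open>Modifying a single entry\<close>

lemma flg_inserted: "flg (inserted cn r b) j \<longleftrightarrow> j = r \<or> flg cn j"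
  by (auto simp: flg_def inserted_def bit_set_bit_iff)

lemma inserted:
  assumes "wf_cnode cn" "\<not> flg cn r"
  shows "wf_cnode (inserted cn r b)" "arr (inserted cn r b) = (arr cn)(r \<mapsto> b)"
proof -
  have "{j. j = r \<or> flg cn j} = insert r {j. flg cn j}" by auto
  then show w: "wf_cnode (inserted cn r b)"
    using assms pos_le_length[OF assms(1), of r]
    by (simp add: wf_cnode_iff flg_inserted finite_flg) (simp add: inserted_def)
  \<comment> \<open>Only indices above \<open>r\<close> gain a flagged predecessor, which matches
    the shift of the cells behind the insertion point.\<close>
  have pos: "pos (inserted cn r b) j = pos cn j + (if r < j then 1 else 0)" for j
  proof (cases "r < j")
    case True
    then have "{i. i < j \<and> (i = r \<or> flg cn i)} = insert r {i. i < j \<and> flg cn i}" by auto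
    with True assms show ?thesis by (simp add: pos_eq flg_inserted finite_flg)
  next
    case False
    then have "{i. i < j \<and> (i = r \<or> flg cn i)} = {i. i < j \<and> flg cn i}" by auto
    with False show ?thesis by (simp add: pos_eq flg_inserted)
  qed
  show "arr (inserted cn r b) = (arr cn)(r \<mapsto> b)"
  proof
    fix j
    let ?n = "pos cn r"
    have n: "?n \<le> length (array cn)" using pos_le_length assms by blast
    have a: "array (inserted cn r b) = take ?n (array cn) @ b # drop ?n (array cn)"
      by (simp add: inserted_def)
    show "arr (inserted cn r b) j = ((arr cn)(r \<mapsto> b)) j"
    proof (cases "j = r \<or> \<not> flg cn j")
      case True
      then show ?thesis
        using n w assms by (auto simp: arr_wf flg_inserted pos a nth_append)
    next
      case False
      \<comment> \<open>Decides on which side of the new cell the cell of \<open>j\<close>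
        lies.\<close>
      have "r < j \<Longrightarrow> ?n \<le> pos cn j" "\<not> r < j \<Longrightarrow> pos cn j < ?n"
        using pos_mono[of r j cn] pos_less[of cn j r] False by auto
      then show ?thesis
        using False n w assms by (auto simp: arr_wf flg_inserted pos a nth_append)
    qed
  qed
qed

lemma updated:
  assumes "wf_cnode cn" "flg cn r"
  shows "wf_cnode (updated cn r b)" "arr (updated cn r b) = (arr cn)(r \<mapsto> b)"
proof -
  have f: "flg (updated cn r b) = flg cn" by (rule ext) (simp add: flg_def updated_def)
  then show w: "wf_cnode (updated cn r b)" using assms by (simp add: wf_cnode_iff) (simp add: updated_def)
  have p: "pos (updated cn r b) = pos cn" using f by (intro ext) (simp add: pos_eq)
  have a: "array (updated cn r b) = (array cn)[pos cn r := b]" by (simp add: updated_def)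
  show "arr (updated cn r b) = (arr cn)(r \<mapsto> b)"
    using w assms pos_less_length[OF assms]
    by (intro ext) (auto simp: arr_wf f p a pos_eq_iff nth_list_update)
qed

lemma flg_removed: "flg (removed cn r) j \<longleftrightarrow> j \<noteq> r \<and> flg cn j"
  by (auto simp: flg_def removed_def bit_unset_bit_iff)

lemma removed:
  assumes "wf_cnode cn" "flg cn r"
  shows "wf_cnode (removed cn r)" "arr (removed cn r) = (arr cn)(r := None)"
proof -
  have l: "pos cn r < length (array cn)" using pos_less_length assms by blast
  have "{j. j \<noteq> r \<and> flg cn j} = {j. flg cn j} - {r}" by auto
  then show w: "wf_cnode (removed cn r)"
    using assms l by (simp add: wf_cnode_iff flg_removed finite_flg) (simp add: removed_def)
  have pos: "pos (removed cn r) j = pos cn j - (if r < j then 1 else 0)" for j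
  proof (cases "r < j")
    case True
    then have "{i. i < j \<and> i \<noteq> r \<and> flg cn i} = {i. i < j \<and> flg cn i} - {r}" by auto
    with True assms show ?thesis by (simp add: pos_eq flg_removed finite_flg)
  next
    case False
    then have "{i. i < j \<and> i \<noteq> r \<and> flg cn i} = {i. i < j \<and> flg cn i}" by auto
    with False show ?thesis by (simp add: pos_eq flg_removed)
  qed
  show "arr (removed cn r) = (arr cn)(r := None)"
  proof
    fix j
    let ?n = "pos cn r"
    have a: "array (removed cn r) = take ?n (array cn) @ drop (Suc ?n) (array cn)"
      by (simp add: removed_def)
    show "arr (removed cn r) j = ((arr cn)(r := None)) j"
    proof (cases "j = r \<or> \<not> flg cn j")
      case True
      then show ?thesis using w assms by (auto simp: arr_wf flg_removed)
    next
      case False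
      \<comment> \<open>Both comparisons are strict because \<open>r\<close> is flagged; hence the
        decrement for \<open>j > r\<close> does not truncate at 0 and points behind the removed
        cell.\<close>
      have "r < j \<Longrightarrow> ?n < pos cn j" "\<not> r < j \<Longrightarrow> pos cn j < ?n"
        using pos_less[of cn r j] pos_less[of cn j r] False assms by auto
      moreover have "pos cn j < length (array cn)" using False assms pos_less_length by blast
      ultimately show ?thesis
        using False l w assms by (auto simp: arr_wf flg_removed pos a nth_append)
    qed
  qed
qed

section \<open>Mapping and filtering all entries\<close>

lemma length_map_filter: "length (List.map_filter f xs) = card {m. m < length xs \<and> f (xs ! m) \<noteq> None}"
  by (simp add: List.map_filter_def length_filter_conv_card)

lemma map_filter_nth:
  assumes "n < length xs" "f (xs ! n) = Some y"
  shows "List.map_filter f xs ! card {m. m < n \<and> f (xs ! m) \<noteq> None} = y"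
proof -
  have "List.map_filter f xs
      = List.map_filter f (take n xs) @ y # List.map_filter f (drop (Suc n) xs)"
    using assms by (subst id_take_nth_drop[OF assms(1)]) (simp add: List.map_filter_def)
  moreover have "length (List.map_filter f (take n xs)) = card {m. m < n \<and> f (xs ! m) \<noteq> None}"
    using assms(1) unfolding length_map_filter by (intro arg_cong[where f = card]) auto
  ultimately show ?thesis by (metis nth_append_length)
qed

text \<open>Filtering acts on array cells, the new bitmap on chunks. The bijection
  \<open>pos\<close> translates between the two, so the rank in the new bitmap equals the number of
  surviving cells in front. The resulting pointwise \<open>Option.bind\<close> hides all index
  arithmetic from later proofs.\<close>

lemma map_entries:
  assumes "wf_cnode cn"
  shows "wf_cnode (map_entries f cn)" "arr (map_entries f cn) = (\<lambda>r. Option.bind (arr cn r) f)"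
proof -
  have fl: "flg (map_entries f cn) r \<longleftrightarrow> flg cn r \<and> f (array cn ! pos cn r) \<noteq> None" for r
    unfolding flg_def map_entries_def by (simp add: bit_sum_exp finite_flg flg_def[symmetric])
  have bij: "bij_betw (pos cn) {j. flg cn j} {..<length (array cn)}"
    using assms by (rule bij_betw_pos)
  then have img: "pos cn ` {j. flg cn j} = {..<length (array cn)}" by (simp add: bij_betw_def)
  have inj: "inj_on (pos cn) {j. flg cn j \<and> P j}" for P by (auto simp: inj_on_def pos_eq_iff)
  have "pos cn ` {j. flg cn j \<and> f (array cn ! pos cn j) \<noteq> None}
      = {m. m < length (array cn) \<and> f (array cn ! m) \<noteq> None}"
    (is "?A = ?B")
  proof
    show "?B \<subseteq> ?A"
    proof
      fix m assume m: "m \<in> ?B"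
      then obtain j where "flg cn j" "m = pos cn j" using img by auto
      with m show "m \<in> ?A" by blast
    qed
  next
    show "?A \<subseteq> ?B" using pos_less_length[OF assms] by auto
  qed
  then show w: "wf_cnode (map_entries f cn)"
    unfolding wf_cnode_iff fl using card_image[OF inj, of "\<lambda>j. f (array cn ! pos cn j) \<noteq> None"]
    by (simp add: map_entries_def length_map_filter)
  have pos: "pos (map_entries f cn) r = card {m. m < pos cn r \<and> f (array cn ! m) \<noteq> None}"
    if "flg cn r" for r
  proof -
    have "m \<in> pos cn ` {j. flg cn j \<and> j < r}" if m: "m < pos cn r" for m
    proof -
      have "m < length (array cn)" using m pos_less_length[OF assms \<open>flg cn r\<close>] by simp
      then obtain j where "flg cn j" "m = pos cn j" using img by auto
      then show ?thesis using m pos_mono[of r j cn] by (cases "j < r") auto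
    qed
    then have "pos cn ` {j. flg cn j \<and> (j < r \<and> f (array cn ! pos cn j) \<noteq> None)}
        = {m. m < pos cn r \<and> f (array cn ! m) \<noteq> None}"
      using pos_less by (fastforce simp: image_iff)
    moreover have "{j. j < r \<and> flg cn j \<and> f (array cn ! pos cn j) \<noteq> None}
        = {j. flg cn j \<and> (j < r \<and> f (array cn ! pos cn j) \<noteq> None)}" by auto
    ultimately show ?thesis unfolding pos_eq[of "map_entries f cn"] fl
      using card_image[OF inj, of "\<lambda>j. j < r \<and> f (array cn ! pos cn j) \<noteq> None"] by simp
  qed
  have "arr (map_entries f cn) r = Option.bind (arr cn r) f" for r
  proof (cases "flg cn r \<and> f (array cn ! pos cn r) \<noteq> None")
    case True
    then obtain y where y: "f (array cn ! pos cn r) = Some y" by blast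
    have "arr (map_entries f cn) r = Some (List.map_filter f (array cn) ! pos (map_entries f cn) r)"
      using True fl by (subst arr_wf[OF w]) (simp add: map_entries_def)
    also have "\<dots> = Some y"
      unfolding pos[OF conjunct1[OF True]]
      using map_filter_nth[of "pos cn r" "array cn" f y] y pos_less_length[OF assms] True by simp
    finally show ?thesis using True y assms by (simp add: arr_wf)
  next
    case False
    then show ?thesis using fl w assms by (auto simp: arr_wf)
  qed
  then show "arr (map_entries f cn) = (\<lambda>r. Option.bind (arr cn r) f)" by (rule ext)
qed

section \<open>Cnodes with at most two entries\<close>

lemma empty_cnode: "wf_cnode (CNode 0 [])" "\<not> flg (CNode 0 []) r" "arr (CNode 0 []) = Map.empty"
  by (auto simp: wf_cnode_def bitcount_def flg_def arr_def fun_eq_iff)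

lemma single_cnode:
  shows "wf_cnode (CNode (2 ^ r) [b])" "arr (CNode (2 ^ r) [b]) = [r \<mapsto> b]"
proof -
  have "inserted (CNode 0 []) r b = CNode (2 ^ r) [b]"
    by (simp add: inserted_def pos_def bitcount_def set_bit_eq)
  then show "wf_cnode (CNode (2 ^ r) [b])" "arr (CNode (2 ^ r) [b]) = [r \<mapsto> b]"
    using inserted[OF empty_cnode(1,2), of r b] by (simp_all add: empty_cnode(3))
qed

text \<open>The cnode arises by inserting \<open>y\<close> into the one-entry cnode of
  \<open>x\<close>; the rank of \<open>ry\<close> there is 0 or 1, and this is the comparison that
  orders the list.\<close>

lemma double_cnode:
  fixes x y :: "('k, 'v) branch"
  assumes "rx \<noteq> ry"
  defines "cn \<equiv> CNode (2 ^ rx + 2 ^ ry) (if rx < ry then [x, y] else [y, x])"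
  shows "wf_cnode cn" "arr cn = [rx \<mapsto> x, ry \<mapsto> y]"
proof -
  let ?c = "CNode (2 ^ rx) [x]"
  have f: "flg ?c j \<longleftrightarrow> j = rx" for j by (auto simp: flg_def bit_exp_iff)
  have "pos ?c ry = (if rx < ry then 1 else 0)"
  proof -
    have "{j. j < ry \<and> j = rx} = (if rx < ry then {rx} else {})" by auto
    then show ?thesis by (simp add: pos_eq f)
  qed
  then have "cn = inserted ?c ry y"
    using f[of ry] assms(1) by (auto simp: cn_def inserted_def set_bit_eq flg_def)
  then show "wf_cnode cn" "arr cn = [rx \<mapsto> x, ry \<mapsto> y]"
    using inserted[OF single_cnode(1), of rx x ry y] f[of ry] assms(1) by (simp_all add: single_cnode(2))
qed


subsection \<open>Invariant\<close>

lemma map_leD: "m \<subseteq>\<^sub>m m' \<Longrightarrow> m a = Some b \<Longrightarrow> m' a = Some b"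
  by (auto simp: map_le_def dom_def)

definition live :: "('k, 'v) store \<Rightarrow> iref \<Rightarrow> bool" where
  "live s i \<longleftrightarrow> (\<exists>c. inodes s i = Some (CNodeMain c))"

text \<open>Common part of the two relations below. Main fields may be overwritten, but nothing is
  deallocated, cnodes keep their contents and existing inodes keep their ghost prefix;
  well-formedness of nodes needs no more to persist.\<close>

definition grows ::
  "('k, 'v) store \<Rightarrow> (iref \<Rightarrow> nat list) \<Rightarrow> ('k, 'v) store \<Rightarrow> (iref \<Rightarrow> nat list) \<Rightarrow> bool" where
  "grows s pre s' pre' \<longleftrightarrow> dom (inodes s) \<subseteq> dom (inodes s') \<and> cnodes s \<subseteq>\<^sub>m cnodes s' \<and>
     (\<forall>j \<in> dom (inodes s). pre' j = pre j)"

text \<open>Allocation without any write: relates the start of a step to the moment when new nodes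
  exist but have not been published.\<close>

definition extends ::
  "('k, 'v) store \<Rightarrow> (iref \<Rightarrow> nat list) \<Rightarrow> ('k, 'v) store \<Rightarrow> (iref \<Rightarrow> nat list) \<Rightarrow> bool" where
  "extends s pre s' pre' \<longleftrightarrow> grows s pre s' pre' \<and> root s' = root s \<and> inodes s \<subseteq>\<^sub>m inodes s'"

text \<open>The rely condition of a thread: what it may assume about the steps of the others.\<close>

definition evolves ::
  "('k, 'v) store \<Rightarrow> (iref \<Rightarrow> nat list) \<Rightarrow> ('k, 'v) store \<Rightarrow> (iref \<Rightarrow> nat list) \<Rightarrow> bool" where
  "evolves s pre s' pre' \<longleftrightarrow> grows s pre s' pre' \<and>
     (\<forall>i mn. inodes s i = Some mn \<and> \<not> live s i \<longrightarrow> inodes s' i = Some mn)"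

text \<open>By the prefix equation a link strictly shortens the prefix upwards, which is the
  termination argument for climbing to the root.\<close>

definition linked_by ::
  "('k, 'v) store \<Rightarrow> (iref \<Rightarrow> nat list) \<Rightarrow> iref \<Rightarrow> iref \<Rightarrow> bool" where
  "linked_by s pre i j \<longleftrightarrow> (\<exists>c cn r. inodes s i = Some (CNodeMain c) \<and> cnodes s c = Some cn \<and>
     pre j = pre i @ [r] \<and> arr cn r = Some (INode j))"

definition linked :: "('k, 'v) store \<Rightarrow> (iref \<Rightarrow> nat list) \<Rightarrow> iref \<Rightarrow> bool" where
  "linked s pre j \<longleftrightarrow> (pre j = [] \<and> root s = Some j) \<or> (\<exists>i. linked_by s pre i j)"

lemma linked_by_live: "linked_by s pre i j \<Longrightarrow> live s i"
  by (auto simp: linked_by_def live_def)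

fun fresh_arr :: "('k, 'v) fresh \<Rightarrow> nat \<Rightarrow> ('k, 'v) branch option" where
  "fresh_arr (NewCNode cn) r = arr cn r"
| "fresh_arr _ r = None"

lemma extends_refl: "extends s pre s pre"
  by (simp add: extends_def grows_def)

lemma alloc_mainD:
  assumes "alloc_main s f s' mn"
  shows "root s' = root s" "inodes s' = inodes s" "cnodes s \<subseteq>\<^sub>m cnodes s'"
    "case f of NewNull \<Rightarrow> mn = Null | NewSNode sn \<Rightarrow> mn = SNodeMain sn
     | NewCNode cn \<Rightarrow> \<exists>c. mn = CNodeMain c \<and> cnodes s' c = Some cn"
  using assms by (induction) (auto simp: new_cnode_def map_le_def)

context
  fixes W :: nat and hashcode :: "'k \<Rightarrow> nat"
begin

lemma has_prefix_Nil: "has_prefix W hashcode k []"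
  by (simp add: has_prefix_def)

lemma has_prefix_snoc:
  "has_prefix W hashcode k (p @ [r]) \<longleftrightarrow>
     has_prefix W hashcode k p \<and> r = chunk W hashcode (length p * W) k"
  by (auto simp: has_prefix_def less_Suc_eq nth_append)

lemma chunk_less: "chunk W hashcode l k < 2 ^ W"
  by (simp add: chunk_def)

text \<open>The main field of a child inode is not inspected. The condition thus stays local and
  survives writes elsewhere.\<close>

definition branch_ok ::
  "('k, 'v) store \<Rightarrow> (iref \<Rightarrow> nat list) \<Rightarrow> nat list \<Rightarrow> ('k, 'v) branch \<Rightarrow> bool" where
  "branch_ok s pre q b \<longleftrightarrow> (case b of
       Leaf sn \<Rightarrow> has_prefix W hashcode (key sn) q
     | INode j \<Rightarrow> j \<in> dom (inodes s) \<and> pre j = q)"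

lemma branch_ok_simps [simp]:
  "branch_ok s pre q (Leaf sn) \<longleftrightarrow> has_prefix W hashcode (key sn) q"
  "branch_ok s pre q (INode j) \<longleftrightarrow> j \<in> dom (inodes s) \<and> pre j = q"
  by (simp_all add: branch_ok_def)

definition cnode_ok ::
  "('k, 'v) store \<Rightarrow> (iref \<Rightarrow> nat list) \<Rightarrow> nat list \<Rightarrow> ('k, 'v) cnode \<Rightarrow> bool" where
  "cnode_ok s pre p cn \<longleftrightarrow> wf_cnode cn \<and>
     (\<forall>r b. arr cn r = Some b \<longrightarrow> r < 2 ^ W \<and> branch_ok s pre (p @ [r]) b)"

lemma cnode_okD:
  assumes "cnode_ok s pre p cn" "arr cn r = Some b"
  shows "r < 2 ^ W" "branch_ok s pre (p @ [r]) b"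
  using assms by (simp_all add: cnode_ok_def)

fun main_ok ::
  "('k, 'v) store \<Rightarrow> (iref \<Rightarrow> nat list) \<Rightarrow> nat list \<Rightarrow> ('k, 'v) main \<Rightarrow> bool" where
  "main_ok s pre p Null \<longleftrightarrow> True"
| "main_ok s pre p (SNodeMain sn) \<longleftrightarrow> tomb sn \<and> has_prefix W hashcode (key sn) p"
| "main_ok s pre p (CNodeMain c) \<longleftrightarrow> (\<exists>cn. cnodes s c = Some cn \<and> cnode_ok s pre p cn)"

fun fresh_ok ::
  "('k, 'v) store \<Rightarrow> (iref \<Rightarrow> nat list) \<Rightarrow> nat list \<Rightarrow> ('k, 'v) fresh \<Rightarrow> bool" where
  "fresh_ok s pre p NewNull \<longleftrightarrow> True"
| "fresh_ok s pre p (NewSNode sn) \<longleftrightarrow> tomb sn \<and> has_prefix W hashcode (key sn) p"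
| "fresh_ok s pre p (NewCNode cn) \<longleftrightarrow> cnode_ok s pre p cn"

definition nodes_ok :: "('k, 'v) store \<Rightarrow> (iref \<Rightarrow> nat list) \<Rightarrow> bool" where
  "nodes_ok s pre \<longleftrightarrow> (\<forall>i mn. inodes s i = Some mn \<longrightarrow> main_ok s pre (pre i) mn)"

definition store_inv :: "('k, 'v) store \<Rightarrow> (iref \<Rightarrow> nat list) \<Rightarrow> bool" where
  "store_inv s pre \<longleftrightarrow> nodes_ok s pre \<and> (\<forall>r. root s = Some r \<longrightarrow> r \<in> dom (inodes s) \<and> pre r = []) \<and>
     (\<forall>i. live s i \<longrightarrow> linked s pre i)"

lemma branch_ok_grows: "branch_ok s pre q b \<Longrightarrow> grows s pre s' pre' \<Longrightarrow> branch_ok s' pre' q b"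
  by (cases b) (auto simp: grows_def)

lemma cnode_ok_grows: "cnode_ok s pre q cn \<Longrightarrow> grows s pre s' pre' \<Longrightarrow> cnode_ok s' pre' q cn"
  using branch_ok_grows unfolding cnode_ok_def by blast

lemma grows_cnodes: "grows s pre s' pre' \<Longrightarrow> cnodes s c = Some cn \<Longrightarrow> cnodes s' c = Some cn"
  by (auto simp: grows_def map_le_def dom_def)

lemma main_ok_grows:
  assumes "main_ok s pre q mn" "grows s pre s' pre'"
  shows "main_ok s' pre' q mn"
  using assms(1) cnode_ok_grows[OF _ assms(2)] grows_cnodes[OF assms(2)]
  by (cases mn) (simp_all, blast)

lemma nodes_okD:
  assumes "nodes_ok s pre" "inodes s i = Some (CNodeMain c)"
  obtains cn where "cnodes s c = Some cn" "cnode_ok s pre (pre i) cn"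
  using assms unfolding nodes_ok_def by fastforce


subsection \<open>The abstract set\<close>

fun branch_has :: "('k, 'v) store \<Rightarrow> nat \<Rightarrow> 'k \<Rightarrow> ('k, 'v) branch option \<Rightarrow> bool" where
  "branch_has s l k None \<longleftrightarrow> False"
| "branch_has s l k (Some (Leaf sn)) \<longleftrightarrow> key sn = k"
| "branch_has s l k (Some (INode j)) \<longleftrightarrow> hasKey_inode W hashcode s j l k"

fun fresh_has :: "('k, 'v) store \<Rightarrow> nat \<Rightarrow> 'k \<Rightarrow> ('k, 'v) fresh \<Rightarrow> bool" where
  "fresh_has s l k NewNull \<longleftrightarrow> False"
| "fresh_has s l k (NewSNode sn) \<longleftrightarrow> key sn = k"
| "fresh_has s l k (NewCNode cn) \<longleftrightarrow> branch_has s (l + W) k (arr cn (chunk W hashcode l k))"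

definition abs_has :: "('k, 'v) store \<Rightarrow> 'k \<Rightarrow> bool" where
  "abs_has s k \<longleftrightarrow> (\<exists>r. root s = Some r \<and> hasKey_inode W hashcode s r 0 k)"

lemma hasKey_cnode_iff:
  assumes "cnodes s c = Some cn"
  shows "hasKey_cnode W hashcode s c l k \<longleftrightarrow>
    branch_has s (l + W) k (arr cn (chunk W hashcode l k))"
proof -
  have "branch_has s (l + W) k b \<longleftrightarrow> (\<exists>sn. b = Some (Leaf sn) \<and> key sn = k) \<or>
     (\<exists>i. b = Some (INode i) \<and> hasKey_inode W hashcode s i (l + W) k)" for b
    by (cases "(s, l + W, k, b)" rule: branch_has.cases) auto
  then show ?thesis using assms
    by (subst hasKey_cnode.simps) (auto simp: holds_cnode_def sub_eq_arr)
qed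

lemma hasKey_inode_iff:
  assumes "inodes s i = Some mn"
  shows "hasKey_inode W hashcode s i l k \<longleftrightarrow> (case mn of Null \<Rightarrow> False
     | SNodeMain sn \<Rightarrow> key sn = k | CNodeMain c \<Rightarrow> hasKey_cnode W hashcode s c l k)"
  using assms by (subst hasKey_inode.simps) (auto simp: holds_inode_def split: main.splits)

lemma hasKey_live:
  assumes "inodes s i = Some (CNodeMain c)" "cnodes s c = Some cn"
  shows "hasKey_inode W hashcode s i l k \<longleftrightarrow> fresh_has s l k (NewCNode cn)"
  using assms by (simp add: hasKey_inode_iff hasKey_cnode_iff)

lemma consistent_iff: "consistent W hashcode s A \<longleftrightarrow> A = {k. abs_has s k}"
  by (auto simp: consistent_def abs_has_def)

text \<open>A derivation of membership visits only nodes on the search path of \<open>k\<close>; if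
  these lie in \<open>D\<close> and the stores agree there, it can be replayed. One direction
  suffices, as the assumptions can also be established with the stores exchanged.\<close>

lemma hasKey_transfer:
  fixes s s' :: "('k, 'v) store"
  assumes agree: "\<And>j l. D j l \<Longrightarrow> inodes s' j = inodes s j"
    and cagree: "\<And>j l c. D j l \<Longrightarrow> inodes s j = Some (CNodeMain c) \<Longrightarrow> cnodes s' c = cnodes s c"
    and closed: "\<And>j l c cn i. D j l \<Longrightarrow> inodes s j = Some (CNodeMain c) \<Longrightarrow> cnodes s c = Some cn \<Longrightarrow>
      arr cn (chunk W hashcode l k) = Some (INode i) \<Longrightarrow> D i (l + W)"
  shows "hasKey_inode W hashcode s j l k \<Longrightarrow> D j l \<Longrightarrow> hasKey_inode W hashcode s' j l k"
proof -
  assume "hasKey_inode W hashcode s j l k" "D j l"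
  \<comment> \<open>The induction varies the key, while the closure of \<open>D\<close> speaks of
    the fixed \<open>k\<close>; the variable \<open>k'\<close> with its equation reconciles the
    two.\<close>
  moreover have
    "hasKey_inode W hashcode s j l k' \<Longrightarrow> k' = k \<longrightarrow> D j l \<longrightarrow> hasKey_inode W hashcode s' j l k'"
    "hasKey_cnode W hashcode s c l k' \<Longrightarrow> k' = k \<longrightarrow>
      (\<forall>j. D j l \<and> inodes s j = Some (CNodeMain c) \<longrightarrow> hasKey_cnode W hashcode s' c l k')"
    for j l c k'
  proof (induction rule: hasKey_inode_hasKey_cnode.inducts)
    case (1 i k' l)
    show ?case
    proof (intro impI)
      assume "D i l"
      with 1 agree show "hasKey_inode W hashcode s' i l k'"
        by (intro hasKey_inode_hasKey_cnode.intros(1)) (simp add: holds_inode_def)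
    qed
  next
    case (2 i c l k')
    show ?case
    proof (intro impI)
      assume "k' = k" "D i l"
      then show "hasKey_inode W hashcode s' i l k'"
        using 2 agree by (intro hasKey_inode_hasKey_cnode.intros(2)[of s' i c]) auto
    qed
  next
    case (3 c cn l k')
    show ?case
    proof (intro impI allI)
      fix j assume "D j l \<and> inodes s j = Some (CNodeMain c)"
      then show "hasKey_cnode W hashcode s' c l k'"
        using 3 cagree by (intro hasKey_inode_hasKey_cnode.intros(3)[of s' c cn]) auto
    qed
  next
    case (4 c cn l k' i)
    show ?case
    proof (intro impI allI)
      fix j assume k: "k' = k" and j: "D j l \<and> inodes s j = Some (CNodeMain c)"
      then have "D i (l + W)" using closed[of j l c cn i] 4 by (simp add: sub_eq_arr)
      then show "hasKey_cnode W hashcode s' c l k'"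
        using 4 j k cagree by (intro hasKey_inode_hasKey_cnode.intros(4)[of s' c cn]) auto
    qed
  qed
  ultimately show ?thesis by blast
qed


end

section \<open>Locality of membership, and writes to main fields\<close>

context
  fixes W :: nat and hashcode :: "'k \<Rightarrow> nat"
begin

text \<open>Here \<open>q\<close> stands for the prefix of an inode being overwritten. Either
  \<open>k\<close> lacks this prefix or the search starts strictly below it; since prefixes only
  grow along a search, the changed inode is never met.\<close>

lemma hasKey_stable:
  assumes ok: "nodes_ok W hashcode s pre"
    and inodes: "\<And>j. j \<in> dom (inodes s) \<Longrightarrow> has_prefix W hashcode k (pre j) \<Longrightarrow>
      (has_prefix W hashcode k q \<Longrightarrow> length q < length (pre j)) \<Longrightarrow> inodes s' j = inodes s j"
    and cnodes: "cnodes s \<subseteq>\<^sub>m cnodes s'"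
    and j: "j \<in> dom (inodes s)" "has_prefix W hashcode k (pre j)"
    and away: "has_prefix W hashcode k q \<Longrightarrow> length q < length (pre j)"
  shows "hasKey_inode W hashcode s' j (length (pre j) * W) k \<longleftrightarrow>
    hasKey_inode W hashcode s j (length (pre j) * W) k"
proof -
  \<comment> \<open>A superset of the inodes that a search for \<open>k\<close> from
    \<open>j\<close> can reach, described by prefix instead of by path.\<close>
  define D where "D j l \<longleftrightarrow> j \<in> dom (inodes s) \<and> l = length (pre j) * W \<and>
    has_prefix W hashcode k (pre j) \<and>
    (has_prefix W hashcode k q \<longrightarrow> length q < length (pre j))" for j l
  have agree: "inodes s' j = inodes s j" if "D j l" for j l
    using that inodes by (auto simp: D_def)
  have cn: "cnodes s' c = cnodes s c \<and> c \<in> dom (cnodes s)"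
    if D: "D j l" and c: "inodes s j = Some (CNodeMain c)" for j l c
  proof -
    obtain cn where "cnodes s c = Some cn" using nodes_okD[OF ok c] .
    then show ?thesis using cnodes by (auto simp: map_le_def dom_def)
  qed
  have closed: "D m (l + W)" if D: "D j l" and c: "inodes s j = Some (CNodeMain c)"
    and cn: "cnodes s c = Some cn" and m: "arr cn (chunk W hashcode l k) = Some (INode m)"
    for j l c cn m
  proof -
    have "cnode_ok W hashcode s pre (pre j) cn" using nodes_okD[OF ok c] cn by auto
    with m have "m \<in> dom (inodes s)" "pre m = pre j @ [chunk W hashcode l k]"
      by (auto dest: cnode_okD)
    with D show ?thesis by (auto simp: D_def has_prefix_snoc)
  qed
  have "D j (length (pre j) * W)" using j away by (simp add: D_def)
  moreover have "hasKey_inode W hashcode s' j l k" if "D j l" "hasKey_inode W hashcode s j l k" for j l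
    by (rule hasKey_transfer[where D = D and s = s]) (use agree cn closed that in \<open>auto\<close>)
  moreover have "hasKey_inode W hashcode s j l k" if "D j l" "hasKey_inode W hashcode s' j l k" for j l
  proof (rule hasKey_transfer[where D = D and s = s'])
    fix j l c assume "D j l" "inodes s' j = Some (CNodeMain c)"
    then show "cnodes s c = cnodes s' c" using agree cn by metis
  next
    fix j l c d i assume "D j l" "inodes s' j = Some (CNodeMain c)" "cnodes s' c = Some d"
      "arr d (chunk W hashcode l k) = Some (INode i)"
    then show "D i (l + W)" using agree cn closed by metis
  qed (use agree that in auto)
  ultimately show ?thesis by blast
qed

text \<open>Only the entry at the chunk of \<open>k\<close> matters, and a child inode there has a
  prefix longer than \<open>p\<close>. So the answer does not depend on the inode with prefix
  \<open>p\<close> into which \<open>f\<close> is to be written.\<close>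

lemma fresh_has_stable:
  assumes ok: "nodes_ok W hashcode s pre" "fresh_ok W hashcode s pre p f"
    and inodes: "\<And>j. j \<in> dom (inodes s) \<Longrightarrow> length p < length (pre j) \<Longrightarrow> inodes s' j = inodes s j"
    and cnodes: "cnodes s \<subseteq>\<^sub>m cnodes s'"
    and k: "has_prefix W hashcode k p"
  shows "fresh_has W hashcode s' (length p * W) k f \<longleftrightarrow> fresh_has W hashcode s (length p * W) k f"
proof (cases f)
  case (NewCNode cn)
  let ?l = "length p * W"
  show ?thesis
  proof (cases "\<exists>j. arr cn (chunk W hashcode ?l k) = Some (INode j)")
    case True
    then obtain j where j: "arr cn (chunk W hashcode ?l k) = Some (INode j)" ..
    then have "j \<in> dom (inodes s)" "pre j = p @ [chunk W hashcode ?l k]"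
      using ok(2) NewCNode by (auto dest: cnode_okD)
    then show ?thesis
      using hasKey_stable[OF ok(1), of k p s' j] inodes cnodes j NewCNode k
      by (simp add: has_prefix_snoc add.commute)
  next
    case False
    then show ?thesis using NewCNode
      by (cases "(s', ?l + W, k, arr cn (chunk W hashcode ?l k))" rule: branch_has.cases) auto
  qed
qed auto

text \<open>Climbing a link removes the last chunk of the prefix, and at the parent a search for
  \<open>k\<close> takes exactly this chunk. So one linked inode answers a question about the whole
  tree.\<close>

lemma abs_has_linked:
  assumes "store_inv W hashcode s pre" "linked s pre i" "has_prefix W hashcode k (pre i)"
  shows "abs_has W hashcode s k \<longleftrightarrow> hasKey_inode W hashcode s i (length (pre i) * W) k"
  using assms(2,3)
proof (induction "length (pre i)" arbitrary: i rule: less_induct)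
  case less
  show ?case
  proof (cases "pre i = [] \<and> root s = Some i")
    case True
    then show ?thesis by (simp add: abs_has_def)
  next
    case False
    then obtain i0 where "linked_by s pre i0 i" using less by (auto simp: linked_def)
    then obtain c cn r where i0: "inodes s i0 = Some (CNodeMain c)" "cnodes s c = Some cn"
      "pre i = pre i0 @ [r]" "arr cn r = Some (INode i)" by (auto simp: linked_by_def)
    have "linked s pre i0" using assms(1) i0 by (auto simp: store_inv_def live_def)
    moreover have p: "has_prefix W hashcode k (pre i0)" "r = chunk W hashcode (length (pre i0) * W) k"
      using less.prems i0 by (auto simp: has_prefix_snoc)
    ultimately have "abs_has W hashcode s k \<longleftrightarrow> hasKey_inode W hashcode s i0 (length (pre i0) * W) k"
      using less i0 by simp
    then show ?thesis using i0 p by (simp add: hasKey_live add.commute)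
  qed
qed

text \<open>Every successful CAS on a main field is an instance. The store \<open>s1\<close> contains the new nodes
  below \<open>f\<close>; \<open>keep\<close> says that no live subtree is lost.\<close>

lemma write_main:
  assumes inv: "store_inv W hashcode s pre"
    and i: "inodes s i = Some (CNodeMain c)" "cnodes s c = Some cn"
    and ext: "extends s pre s1 pre1" and ok1: "nodes_ok W hashcode s1 pre1"
    and new: "\<And>j. live s1 j \<Longrightarrow> j \<notin> dom (inodes s) \<Longrightarrow>
      (\<exists>j'. j' \<notin> dom (inodes s) \<and> linked_by s1 pre1 j' j) \<or>
      (\<exists>r. pre1 j = pre i @ [r] \<and> fresh_arr f r = Some (INode j))"
    and f: "fresh_ok W hashcode s1 pre1 (pre i) f" "alloc_main s1 f s2 mn"
    and keep: "\<And>r j. arr cn r = Some (INode j) \<Longrightarrow> live s j \<Longrightarrow> fresh_arr f r = Some (INode j)"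
  defines "s' \<equiv> write_main s2 i mn"
  shows "store_inv W hashcode s' pre1" (is ?inv)
    and "evolves s pre s' pre1" (is ?evolves)
    and "abs_has W hashcode s' k \<longleftrightarrow> (if has_prefix W hashcode k (pre i)
      then fresh_has W hashcode s1 (length (pre i) * W) k f else abs_has W hashcode s k)" (is ?abs)
    and "has_prefix W hashcode k (pre i) \<Longrightarrow> abs_has W hashcode s k \<longleftrightarrow>
      fresh_has W hashcode s (length (pre i) * W) k (NewCNode cn)"
proof -
  note a = alloc_mainD[OF f(2)]
  have g: "grows s pre s1 pre1" "root s1 = root s" "inodes s \<subseteq>\<^sub>m inodes s1"
    using ext by (auto simp: extends_def)
  have in1: "inodes s1 j = inodes s j" if "j \<in> dom (inodes s)" for j
    using g(3) that by (auto simp: map_le_def)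
  have pre1: "pre1 j = pre j" if "j \<in> dom (inodes s)" for j
    using g(1) that by (auto simp: grows_def)
  have idom: "i \<in> dom (inodes s)" using i by auto
  have dom1: "dom (inodes s) \<subseteq> dom (inodes s1)" using g(1) by (simp add: grows_def)
  have s': "inodes s' = (inodes s1)(i \<mapsto> mn)" "cnodes s' = cnodes s2" "root s' = root s"
    using a g by (simp_all add: s'_def write_main_def)
  have g': "grows s1 pre1 s' pre1"
    using a(3) by (auto simp: grows_def s')
  then have g2: "grows s pre s' pre1"
    using g(1) map_le_trans unfolding grows_def by (metis subset_iff)
  have cn_le: "cnodes s x = Some y \<Longrightarrow> cnodes s' x = Some y" for x y
    using g2 grows_cnodes by metis
  have ok: "nodes_ok W hashcode s pre" using inv by (simp add: store_inv_def)
  have mn: "main_ok W hashcode s' pre1 (pre i) mn"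
    using f(1) a(4) cnode_ok_grows[OF _ g'] by (cases f) (auto simp: s')
  have ok': "nodes_ok W hashcode s' pre1"
    unfolding nodes_ok_def
  proof (intro allI impI)
    fix j m assume "inodes s' j = Some m"
    then show "main_ok W hashcode s' pre1 (pre1 j) m"
      using mn pre1[OF idom] main_ok_grows[OF _ g'] ok1
      by (cases "j = i") (auto simp: s' nodes_ok_def)
  qed
  have via_i: "linked_by s' pre1 i j" if "pre1 j = pre i @ [r]" "fresh_arr f r = Some (INode j)" for j r
    using that a(4) pre1[OF idom] by (cases f) (auto simp: linked_by_def s')
  \<comment> \<open>A link that leaves \<open>i\<close> is carried over to the new main value by
    \<open>keep\<close>; a link that leaves another inode is untouched, because only the main field
    of \<open>i\<close> is written.\<close>
  have keep_linked: "linked s' pre1 j" if j: "linked s pre j" "live s j" for j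
  proof (cases "pre j = [] \<and> root s = Some j")
    case True
    moreover have "j \<in> dom (inodes s)" using j by (auto simp: live_def)
    ultimately show ?thesis using pre1 by (auto simp: linked_def s')
  next
    case False
    have jd: "j \<in> dom (inodes s)" using j by (auto simp: live_def)
    from False obtain i0 where "linked_by s pre i0 j" using j by (auto simp: linked_def)
    then obtain c0 cn0 r where i0: "inodes s i0 = Some (CNodeMain c0)" "cnodes s c0 = Some cn0"
      "pre j = pre i0 @ [r]" "arr cn0 r = Some (INode j)" by (auto simp: linked_by_def)
    show ?thesis
    proof (cases "i0 = i")
      case True
      then have "fresh_arr f r = Some (INode j)" using i i0 keep j by auto
      then show ?thesis using via_i[of j r] i0 True pre1[OF jd] by (auto simp: linked_def)
    next
      case False
      then have "inodes s' i0 = Some (CNodeMain c0)" using in1[of i0] i0 by (auto simp: s')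
      moreover have "pre1 j = pre1 i0 @ [r]" using i0(3) pre1[OF jd] pre1[OF domI, OF i0(1)] by simp
      ultimately have "linked_by s' pre1 i0 j"
        using cn_le[OF i0(2)] i0(4) unfolding linked_by_def by blast
      then show ?thesis by (auto simp: linked_def)
    qed
  qed
  have lv: "linked s' pre1 j" if "live s' j" for j
  proof (cases "j \<in> dom (inodes s)")
    case True
    then have "live s j" using that i in1[of j] by (cases "j = i") (auto simp: live_def s')
    then show ?thesis using keep_linked inv by (auto simp: store_inv_def)
  next
    case False
    then have "live s1 j" using that idom by (cases "j = i") (auto simp: live_def s')
    then consider j' where "j' \<notin> dom (inodes s)" "linked_by s1 pre1 j' j"
      | r where "pre1 j = pre i @ [r]" "fresh_arr f r = Some (INode j)"
      using new False by blast
    then show ?thesis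
    proof cases
      case 1
      then have "j' \<noteq> i" using idom by auto
      then have "linked_by s' pre1 j' j"
        using 1(2) grows_cnodes[OF g'] by (fastforce simp: linked_by_def s')
      then show ?thesis by (auto simp: linked_def)
    next
      case 2
      then show ?thesis using via_i by (auto simp: linked_def)
    qed
  qed
  have rt: "r \<in> dom (inodes s') \<and> pre1 r = []" if "root s' = Some r" for r
    using inv that g2 by (auto simp: store_inv_def s'(3) grows_def)
  show inv': ?inv
    using ok' rt lv by (auto simp: store_inv_def)
  show ?evolves
    using g2 in1[OF domI] i by (auto simp: evolves_def s' live_def)
  have lnk: "linked s pre i" "live s i" using inv i by (auto simp: store_inv_def live_def)
  have has_old: "abs_has W hashcode s k \<longleftrightarrow>
      fresh_has W hashcode s (length (pre i) * W) k (NewCNode cn)" if "has_prefix W hashcode k (pre i)"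
    using abs_has_linked[OF inv lnk(1) that] i by (simp add: hasKey_live)
  then show "has_prefix W hashcode k (pre i) \<Longrightarrow> abs_has W hashcode s k \<longleftrightarrow>
      fresh_has W hashcode s (length (pre i) * W) k (NewCNode cn)" .
  show ?abs
  proof (cases "has_prefix W hashcode k (pre i)")
    case True
    let ?l = "length (pre i) * W"
    have "abs_has W hashcode s' k \<longleftrightarrow> hasKey_inode W hashcode s' i ?l k"
      using abs_has_linked[OF inv' keep_linked[OF lnk], of k] True pre1[OF idom] by simp
    also have "\<dots> \<longleftrightarrow> fresh_has W hashcode s' ?l k f"
      using a(4) hasKey_inode_iff[of s' i mn W hashcode ?l k]
      by (cases f) (auto simp: s' hasKey_cnode_iff)
    \<comment> \<open>Among the inodes only \<open>i\<close> differs from \<open>s1\<close>, and the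
      entries of \<open>f\<close> lie strictly below \<open>i\<close>.\<close>
    also have "\<dots> \<longleftrightarrow> fresh_has W hashcode s1 ?l k f"
      using True a(3) pre1[OF idom] by (intro fresh_has_stable[OF ok1 f(1)]) (auto simp: s')
    finally show ?thesis using True by simp
  next
    case False
    \<comment> \<open>A search for \<open>k\<close> from the root passes only inodes whose prefix
      \<open>k\<close> has, so it cannot pass \<open>i\<close>.\<close>
    have "hasKey_inode W hashcode s' r 0 k \<longleftrightarrow> hasKey_inode W hashcode s r 0 k"
      if "root s = Some r" for r
    proof -
      have "r \<in> dom (inodes s)" "pre r = []" using inv that by (auto simp: store_inv_def)
      moreover have "inodes s' j = inodes s j"
        if "j \<in> dom (inodes s)" "has_prefix W hashcode k (pre j)" for j
        using that False in1 by (auto simp: s')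
      ultimately show ?thesis
        using hasKey_stable[OF ok, of k "pre i" s' r] False g2
        by (simp add: has_prefix_Nil grows_def)
    qed
    then show ?thesis using False by (auto simp: abs_has_def s')
  qed
qed

end


subsection \<open>New subtrees\<close>

context
  fixes W :: nat and hashcode :: "'k \<Rightarrow> nat"
begin

definition sprouts :: "('k, 'v) store \<Rightarrow> (iref \<Rightarrow> nat list) \<Rightarrow> nat list \<Rightarrow>
    ('k, 'v) store \<Rightarrow> (iref \<Rightarrow> nat list) \<Rightarrow> ('k, 'v) cnode \<Rightarrow> bool" where
  "sprouts s pre p s1 pre1 cn \<longleftrightarrow>
     extends s pre s1 pre1 \<and> nodes_ok W hashcode s1 pre1 \<and> cnode_ok W hashcode s1 pre1 p cn \<and>
     (\<forall>j. live s1 j \<and> j \<notin> dom (inodes s) \<longrightarrow>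
        (\<exists>j'. j' \<notin> dom (inodes s) \<and> linked_by s1 pre1 j' j) \<or>
        (\<exists>r. pre1 j = p @ [r] \<and> arr cn r = Some (INode j)))"

lemma nodes_ok_new_cnode:
  assumes "nodes_ok W hashcode s pre" "new_cnode s cn s' c"
  shows "grows s pre s' pre" "nodes_ok W hashcode s' pre" "inodes s' = inodes s"
    "root s' = root s" "cnodes s' c = Some cn"
proof -
  show g: "grows s pre s' pre" and i: "inodes s' = inodes s" "root s' = root s" "cnodes s' c = Some cn"
    using assms by (auto simp: new_cnode_def grows_def map_le_def)
  show "nodes_ok W hashcode s' pre"
    using assms(1) main_ok_grows[OF _ g] by (simp add: nodes_ok_def i)
qed

lemma sprouts_new_cnode:
  assumes "sprouts s pre p s1 pre1 cn" "new_cnode s1 cn' s2 c"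
  shows "sprouts s pre p s2 pre1 cn"
proof -
  note n = nodes_ok_new_cnode[OF _ assms(2), of pre1]
  have ok: "nodes_ok W hashcode s1 pre1" using assms(1) by (simp add: sprouts_def)
  have "extends s pre s2 pre1"
    using n[OF ok] assms(1) map_le_trans by (fastforce simp: sprouts_def extends_def grows_def)
  moreover have "linked_by s2 pre1 i j" if "linked_by s1 pre1 i j" for i j
    using that n[OF ok] grows_cnodes[OF n(1)[OF ok]] by (fastforce simp: linked_by_def)
  ultimately show ?thesis
    using assms(1) n[OF ok] cnode_ok_grows[OF _ n(1)[OF ok]]
    unfolding sprouts_def live_def by metis
qed

text \<open>Puts one more level on top; the ghost prefix of the new inode is chosen here.
  Well-formedness of \<open>cn'\<close> is assumed for all grown stores because it has to hold after
  this choice.\<close>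

lemma sprouts_new_inode:
  assumes sp: "sprouts s pre (p @ [r]) s1 pre1 cn" "cnodes s1 c = Some cn"
    and i: "new_inode s1 (CNodeMain c) s2 i"
    and ok: "\<And>s' pre'. grows s pre s' pre' \<Longrightarrow> i \<in> dom (inodes s') \<Longrightarrow> pre' i = p @ [r] \<Longrightarrow>
      cnode_ok W hashcode s' pre' p cn'"
    and r: "arr cn' r = Some (INode i)"
  shows "sprouts s pre p s2 (pre1(i := p @ [r])) cn'"
proof -
  let ?pre = "pre1(i := p @ [r])"
  have s2: "i \<notin> dom (inodes s1)" "inodes s2 = (inodes s1)(i \<mapsto> CNodeMain c)"
    "cnodes s2 = cnodes s1" "root s2 = root s1"
    using i by (auto simp: new_inode_def)
  have g1: "grows s1 pre1 s2 ?pre" using s2 by (auto simp: grows_def)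
  have e: "extends s pre s1 pre1" using sp(1) by (simp add: sprouts_def)
  have i_new: "i \<notin> dom (inodes s)" using s2(1) e by (auto simp: extends_def grows_def)
  have e2: "extends s pre s2 ?pre"
    using e i_new by (auto simp: extends_def grows_def map_le_def s2)
  have c: "main_ok W hashcode s2 ?pre (p @ [r]) (CNodeMain c)"
    using sp g1 cnode_ok_grows by (auto simp: sprouts_def s2)
  have "nodes_ok W hashcode s2 ?pre"
    unfolding nodes_ok_def
  proof (intro allI impI)
    fix j m assume "inodes s2 j = Some m"
    then show "main_ok W hashcode s2 ?pre (?pre j) m"
      using c main_ok_grows[OF _ g1] sp(1)
      by (cases "j = i") (auto simp: s2(2) sprouts_def nodes_ok_def)
  qed
  moreover have "cnode_ok W hashcode s2 ?pre p cn'"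
    using ok[of s2 ?pre] e2 s2 by (simp add: extends_def)
  moreover have "(\<exists>j'. j' \<notin> dom (inodes s) \<and> linked_by s2 ?pre j' j) \<or>
        (\<exists>r. ?pre j = p @ [r] \<and> arr cn' r = Some (INode j))"
    if j: "live s2 j" "j \<notin> dom (inodes s)" for j
  proof (cases "j = i")
    case False
    then have "live s1 j" using j by (simp add: live_def s2)
    then consider j' where "j' \<notin> dom (inodes s)" "linked_by s1 pre1 j' j"
      | q where "pre1 j = (p @ [r]) @ [q]" "arr cn q = Some (INode j)"
      using sp(1) j unfolding sprouts_def by blast
    then show ?thesis
    proof cases
      case 1
      then have "live s1 j'" by (simp add: linked_by_live)
      then have "j' \<noteq> i" using s2(1) by (auto simp: live_def)
      then have "linked_by s2 ?pre j' j" using 1 False by (auto simp: linked_by_def s2)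
      then show ?thesis using 1 by blast
    next
      case 2
      \<comment> \<open>The entries of \<open>cn\<close> were still without a parent inode; now the
        new inode \<open>i\<close> is their parent.\<close>
      then have "linked_by s2 ?pre i j" using False sp(2) by (auto simp: linked_by_def s2)
      then show ?thesis using i_new by blast
    qed
  qed (use r in simp)
  ultimately show ?thesis using e2 unfolding sprouts_def by blast
qed

lemma sprouts_refl:
  assumes "nodes_ok W hashcode s pre" "cnode_ok W hashcode s pre p cn"
  shows "sprouts s pre p s pre cn"
  using assms by (auto simp: sprouts_def extends_refl live_def)

text \<open>Each level of the recursion appends the chunk shared by both keys, so both still have
  the longer prefix required below.\<close>

lemma dual_sprouts:
  assumes "dual W hashcode s l x y s' c" "nodes_ok W hashcode s pre" "l = length p * W"
    "has_prefix W hashcode (key x) p" "has_prefix W hashcode (key y) p"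
  shows "\<exists>pre' cn. cnodes s' c = Some cn \<and> sprouts s pre p s' pre' cn"
  using assms
proof (induction arbitrary: p)
  case (distinct rx l x ry y s s' c)
  let ?cn = "CNode (2 ^ rx + 2 ^ ry) (if rx < ry then [Leaf x, Leaf y] else [Leaf y, Leaf x])"
  have cn: "wf_cnode ?cn" "arr ?cn = [rx \<mapsto> Leaf x, ry \<mapsto> Leaf y]"
    using double_cnode[OF \<open>rx \<noteq> ry\<close>, of "Leaf x" "Leaf y"] by auto
  have "cnode_ok W hashcode s pre p ?cn"
    using cn distinct by (auto simp: cnode_ok_def chunk_less has_prefix_snoc split: if_splits)
  with distinct have "sprouts s pre p s' pre ?cn"
    by (intro sprouts_new_cnode[OF sprouts_refl])
  moreover have "cnodes s' c = Some ?cn" using distinct by (simp add: new_cnode_def)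
  ultimately show ?case by blast
next
  case (equal l x y s s1 c1 s2 i s' c)
  let ?r = "chunk W hashcode l (key x)"
  let ?cn = "CNode (2 ^ ?r) [INode i]"
  obtain pre1 cn1 where 1: "cnodes s1 c1 = Some cn1" "sprouts s pre (p @ [?r]) s1 pre1 cn1"
  proof -
    have "\<exists>pre1 cn1. cnodes s1 c1 = Some cn1 \<and> sprouts s pre (p @ [?r]) s1 pre1 cn1"
      using equal.prems equal.hyps(1) by (intro equal.IH) (simp_all add: has_prefix_snoc)
    then show thesis using that by blast
  qed
  have "sprouts s pre p s2 (pre1(i := p @ [?r])) ?cn"
    using 1(2,1) equal.hyps(3)
    by (rule sprouts_new_inode) (auto simp: cnode_ok_def single_cnode chunk_less split: if_splits)
  then have "sprouts s pre p s' (pre1(i := p @ [?r])) ?cn"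
    using equal.hyps(4) by (rule sprouts_new_cnode)
  moreover have "cnodes s' c = Some ?cn" using equal.hyps(4) by (simp add: new_cnode_def)
  ultimately show ?case by blast
qed

text \<open>The inner nodes are completed in an earlier store than the outer ones; the arbitrary
  extension \<open>s''\<close> lets the induction evaluate all of them in one final store.\<close>

lemma hasKey_dual:
  assumes "dual W hashcode s l x y s' c" "cnodes s' \<subseteq>\<^sub>m cnodes s''" "inodes s' \<subseteq>\<^sub>m inodes s''"
  shows "hasKey_cnode W hashcode s'' c l k \<longleftrightarrow> k = key x \<or> k = key y"
  using assms
proof (induction)
  case (distinct rx l x ry y s s' c)
  let ?cn = "CNode (2 ^ rx + 2 ^ ry) (if rx < ry then [Leaf x, Leaf y] else [Leaf y, Leaf x])"
  have "arr ?cn = [rx \<mapsto> Leaf x, ry \<mapsto> Leaf y]"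
    using double_cnode[OF \<open>rx \<noteq> ry\<close>, of "Leaf x" "Leaf y"] by auto
  moreover have "cnodes s'' c = Some ?cn"
    using distinct by (intro map_leD[OF distinct.prems(1)]) (simp add: new_cnode_def)
  ultimately show ?case using distinct(1-3) by (auto simp: hasKey_cnode_iff)
next
  case (equal l x y s s1 c1 s2 i s' c)
  let ?r = "chunk W hashcode l (key x)"
  have s': "cnodes s' = (cnodes s1)(c \<mapsto> CNode (2 ^ ?r) [INode i])" "c \<notin> dom (cnodes s1)"
    "inodes s' = (inodes s1)(i \<mapsto> CNodeMain c1)" "i \<notin> dom (inodes s1)"
    using equal.hyps by (auto simp: new_cnode_def new_inode_def)
  have "cnodes s1 \<subseteq>\<^sub>m cnodes s'" "inodes s1 \<subseteq>\<^sub>m inodes s'"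
    using s' by (auto simp: map_le_def)
  then have "hasKey_cnode W hashcode s'' c1 (l + W) k \<longleftrightarrow> k = key x \<or> k = key y"
    using equal.prems by (intro equal.IH) (auto intro: map_le_trans)
  moreover have "cnodes s'' c = Some (CNode (2 ^ ?r) [INode i])" "inodes s'' i = Some (CNodeMain c1)"
    using equal.prems[THEN map_leD] s' by auto
  ultimately show ?case using equal.hyps(1)
    by (auto simp: hasKey_cnode_iff hasKey_inode_iff single_cnode split: if_splits)
qed

text \<open>Collects what installing the copy by a CAS requires: a private subtree, no lost inode
  entry, and exactly one added key. A search for a key without prefix \<open>p\<close> never gets to
  this cnode, hence the restriction on \<open>k'\<close>.\<close>

lemma insert_copy:
  assumes "insert_copy W hashcode s l k v cn s1 cn'"
    and ok: "nodes_ok W hashcode s pre" "cnode_ok W hashcode s pre p cn"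
    and l: "l = length p * W" and k: "has_prefix W hashcode k p"
  shows "\<exists>pre1. sprouts s pre p s1 pre1 cn'"
    and "arr cn r = Some (INode j) \<Longrightarrow> arr cn' r = Some (INode j)"
    and "has_prefix W hashcode k' p \<Longrightarrow> fresh_has W hashcode s1 l k' (NewCNode cn') \<longleftrightarrow>
      fresh_has W hashcode s l k' (NewCNode cn) \<or> k' = k"
proof -
  let ?r = "chunk W hashcode l k"
  have wf: "wf_cnode cn" using ok(2) by (simp add: cnode_ok_def)
  have upd: "cnode_ok W hashcode s' pre' p cn''"
    if "grows s pre s' pre'" "wf_cnode cn''" "arr cn'' = (arr cn)(?r \<mapsto> b)"
      "branch_ok W hashcode s' pre' (p @ [?r]) b" for s' pre' cn'' b
    using cnode_ok_grows[OF ok(2) that(1)] that by (auto simp: cnode_ok_def chunk_less)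
  have g: "grows s pre s pre" using extends_refl[of s pre] by (simp add: extends_def)
  have leaf: "branch_ok W hashcode s pre (p @ [?r]) (Leaf (SNode k v False))"
    using k l by (simp add: has_prefix_snoc)
  from assms(1) have "(\<exists>pre1. sprouts s pre p s1 pre1 cn') \<and>
    (\<forall>r j. arr cn r = Some (INode j) \<longrightarrow> arr cn' r = Some (INode j)) \<and>
    (\<forall>k'. has_prefix W hashcode k' p \<longrightarrow> (fresh_has W hashcode s1 l k' (NewCNode cn') \<longleftrightarrow>
      fresh_has W hashcode s l k' (NewCNode cn) \<or> k' = k))"
  proof cases
    case unset
    note c = inserted[OF wf unset(3), of "Leaf (SNode k v False)"]
    have "sprouts s pre p s pre cn'"
      using sprouts_refl[OF ok(1) upd[OF g c leaf]] unset by simp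
    then show ?thesis using unset c(2) wf by (auto simp: arr_wf)
  next
    case (same_key sn)
    then have f: "flg cn ?r" by (auto simp: sub_def split: if_splits)
    note c = updated[OF wf f, of "Leaf (SNode k v False)"]
    have "sprouts s pre p s pre cn'"
      using sprouts_refl[OF ok(1) upd[OF g c leaf]] same_key by simp
    then show ?thesis using same_key c(2) by (auto simp: sub_eq_arr)
  next
    case (other_key sn s0 c i)
    then have f: "flg cn ?r" by (auto simp: sub_def split: if_splits)
    note cn' = updated[OF wf f, of "INode i"]
    have sn: "arr cn ?r = Some (Leaf sn)" using other_key by (simp add: sub_eq_arr)
    then have "has_prefix W hashcode (key sn) (p @ [?r])" using cnode_okD[OF ok(2)] by fastforce
    then obtain pre0 cn0 where 0: "cnodes s0 c = Some cn0" "sprouts s pre (p @ [?r]) s0 pre0 cn0"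
      using dual_sprouts[OF other_key(5) ok(1), of "p @ [?r]"] k l
      by (auto simp: has_prefix_snoc add.commute)
    have sp: "sprouts s pre p s1 (pre0(i := p @ [?r])) cn'"
      using 0(2,1) other_key(6)
    proof (rule sprouts_new_inode)
      fix s' pre' assume "grows s pre s' pre'" "i \<in> dom (inodes s')" "pre' i = p @ [?r]"
      then show "cnode_ok W hashcode s' pre' p cn'" using upd cn' other_key(1) by simp
    qed (use cn' other_key in simp)
    have s1: "inodes s1 = (inodes s0)(i \<mapsto> CNodeMain c)" "cnodes s1 = cnodes s0" "i \<notin> dom (inodes s0)"
      using other_key(6) by (auto simp: new_inode_def)
    have has: "hasKey_inode W hashcode s1 i (l + W) k' \<longleftrightarrow> k' = key sn \<or> k' = k" for k'
      using hasKey_dual[OF other_key(5), of s1 k'] s1 by (auto simp: hasKey_inode_iff map_le_def)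
    \<comment> \<open>The old cnode gives the same answers after the allocation of the new subtree,
      since existing inodes are unchanged.\<close>
    have "fresh_has W hashcode s1 l k' (NewCNode cn) \<longleftrightarrow> fresh_has W hashcode s l k' (NewCNode cn)"
      if "has_prefix W hashcode k' p" for k'
      unfolding l using ok sp that
      by (intro fresh_has_stable) (auto simp: sprouts_def extends_def grows_def map_le_def)
    then show ?thesis using sp has sn cn'(2) other_key(1) by auto
  qed
  then show "\<exists>pre1. sprouts s pre p s1 pre1 cn'"
    and "arr cn r = Some (INode j) \<Longrightarrow> arr cn' r = Some (INode j)"
    and "has_prefix W hashcode k' p \<Longrightarrow> fresh_has W hashcode s1 l k' (NewCNode cn') \<longleftrightarrow>
      fresh_has W hashcode s l k' (NewCNode cn) \<or> k' = k"
    by blast+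
qed

end


subsection \<open>Compression and contraction\<close>

text \<open>The changes that clean-up makes to entries of a cnode that stays a cnode. None affects
  membership: the dropped inode holds nothing, and the leaf has the key of the snode it replaces.
  Only the key is prescribed, so the copy may clear the tomb flag.\<close>

inductive entry_step ::
  "('k, 'v) store \<Rightarrow> ('k, 'v) branch option \<Rightarrow> ('k, 'v) branch option \<Rightarrow> bool" for s where
  keep: "entry_step s b b"
| drop: "inodes s j = Some Null \<Longrightarrow> entry_step s (Some (INode j)) None"
| resurrect: "\<lbrakk>inodes s j = Some (SNodeMain sn); key sn' = key sn\<rbrakk> \<Longrightarrow>
    entry_step s (Some (INode j)) (Some (Leaf sn'))"

text \<open>No claim is made about an inode seen with a cnode, since it may have changed meanwhile;
  compression leaves such an entry as it is.\<close>

definition observed :: "('k, 'v) store \<Rightarrow> ('k, 'v) obs \<Rightarrow> bool" where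
  "observed s obs \<longleftrightarrow>
     (\<forall>j mn. obs j = Some mn \<and> (\<forall>c. mn \<noteq> CNodeMain c) \<longrightarrow> inodes s j = Some mn)"

lemma entry_step_null_inode:
  "observed s obs \<Longrightarrow> null_inode obs b \<Longrightarrow> entry_step s (Some b) None"
  by (auto simp: null_inode_def observed_def intro!: entry_step.drop)

lemma observedD:
  "observed s obs \<Longrightarrow> obs j = Some (SNodeMain sn) \<Longrightarrow> inodes s j = Some (SNodeMain sn)"
  by (auto simp: observed_def)

lemma resurrect_eq_Leaf:
  assumes "observed s obs" "resurrect obs b = Leaf sn"
  obtains "b = Leaf sn"
  | j sn0 where "b = INode j" "inodes s j = Some (SNodeMain sn0)" "key sn = key sn0"
proof -
  have "b = Leaf sn \<or> (\<exists>j sn0. b = INode j \<and> obs j = Some (SNodeMain sn0) \<and> key sn = key sn0)"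
    using assms(2) unfolding resurrect_def
    by (auto split: branch.splits option.splits main.splits snode.splits bool.splits)
  then show thesis using that observedD[OF assms(1)] by blast
qed

lemma resurrect_eq_INode: "resurrect obs b = INode j \<Longrightarrow> b = INode j"
  unfolding resurrect_def
  by (auto split: branch.splits option.splits main.splits snode.splits bool.splits)

lemma entry_step_resurrect:
  assumes "observed s obs"
  shows "entry_step s (Some b) (Some (resurrect obs b))"
proof (cases "resurrect obs b")
  case (INode j)
  then show ?thesis using resurrect_eq_INode[OF INode] by (auto intro: keep)
next
  case (Leaf sn)
  from assms Leaf show ?thesis
    by (rule resurrect_eq_Leaf) (use Leaf in \<open>auto intro: keep entry_step.resurrect\<close>)
qed


context
  fixes W :: nat and hashcode :: "'k \<Rightarrow> nat"
begin

text \<open>Conditions under which a CAS from \<open>cn\<close> to \<open>f\<close> is invisible to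
  the abstract set and cuts off no live inode.\<close>

definition replaces :: "('k, 'v) store \<Rightarrow> (iref \<Rightarrow> nat list) \<Rightarrow> nat list \<Rightarrow>
    ('k, 'v) cnode \<Rightarrow> ('k, 'v) fresh \<Rightarrow> bool" where
  "replaces s pre p cn f \<longleftrightarrow> fresh_ok W hashcode s pre p f \<and>
     (\<forall>r j. arr cn r = Some (INode j) \<and> live s j \<longrightarrow> fresh_arr f r = Some (INode j)) \<and>
     (\<forall>k. has_prefix W hashcode k p \<longrightarrow> fresh_has W hashcode s (length p * W) k f =
        fresh_has W hashcode s (length p * W) k (NewCNode cn))"

lemma replaces_write:
  assumes inv: "store_inv W hashcode s pre"
    and i: "inodes s i = Some (CNodeMain c)" "cnodes s c = Some cn"
    and f: "replaces s pre (pre i) cn f" "alloc_main s f s2 mn"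
  shows "store_inv W hashcode (write_main s2 i mn) pre" "evolves s pre (write_main s2 i mn) pre"
    "abs_has W hashcode (write_main s2 i mn) k \<longleftrightarrow> abs_has W hashcode s k"
proof -
  have ok: "nodes_ok W hashcode s pre" using inv by (simp add: store_inv_def)
  \<comment> \<open>Vacuous: no inode is allocated, and a live inode is in the domain.\<close>
  have new: "(\<exists>j'. j' \<notin> dom (inodes s) \<and> linked_by s pre j' j) \<or>
      (\<exists>r. pre j = pre i @ [r] \<and> fresh_arr f r = Some (INode j))"
    if "live s j" "j \<notin> dom (inodes s)" for j
    using that by (auto simp: live_def)
  have fok: "fresh_ok W hashcode s pre (pre i) f"
    and keep: "\<And>r j. arr cn r = Some (INode j) \<Longrightarrow> live s j \<Longrightarrow> fresh_arr f r = Some (INode j)"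
    using f(1) by (simp_all add: replaces_def)
  note w = write_main[OF inv i extends_refl ok new fok f(2) keep]
  show "store_inv W hashcode (write_main s2 i mn) pre" "evolves s pre (write_main s2 i mn) pre"
    using w(1,2) by blast+
  show "abs_has W hashcode (write_main s2 i mn) k \<longleftrightarrow> abs_has W hashcode s k"
    using w(3,4)[of k] f(1) by (cases "has_prefix W hashcode k (pre i)") (simp_all add: replaces_def)
qed

text \<open>Membership and prefixes are checked chunk by chunk, and different chunks do not
  interact.\<close>

lemma replaces_entries:
  assumes ok: "nodes_ok W hashcode s pre" "cnode_ok W hashcode s pre p cn"
    and wf: "wf_cnode cn'" and step: "\<And>r. entry_step s (arr cn r) (arr cn' r)"
  shows "replaces s pre p cn (NewCNode cn')"
proof -
  have "r < 2 ^ W \<and> branch_ok W hashcode s pre (p @ [r]) b" if b: "arr cn' r = Some b" for r b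
    using step[of r]
  proof cases
    case keep
    then show ?thesis using b cnode_okD[OF ok(2), of r b] by simp
  next
    case (resurrect j sn sn')
    then have "r < 2 ^ W" "pre j = p @ [r]" using cnode_okD[OF ok(2), of r "INode j"] by auto
    \<comment> \<open>The tomb has the prefix of its inode \<open>j\<close>, which is
      \<open>p\<close> followed by \<open>r\<close>: just what a leaf at chunk \<open>r\<close>
      needs.\<close>
    moreover have "main_ok W hashcode s pre (pre j) (SNodeMain sn)"
      using ok(1) resurrect unfolding nodes_ok_def by blast
    moreover have "b = Leaf sn'" using b resurrect by simp
    ultimately show ?thesis using resurrect by simp
  qed (use b in simp)
  moreover have "arr cn' r = Some (INode j)" if "arr cn r = Some (INode j)" "live s j" for r j
    using step[of r] that by cases (auto simp: live_def)
  moreover have "branch_has W hashcode s l k (arr cn' r) = branch_has W hashcode s l k (arr cn r)"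
    for l k r
    using step[of r] by cases (auto simp: hasKey_inode_iff)
  ultimately show ?thesis using wf by (simp add: replaces_def cnode_ok_def)
qed

lemma replaces_refl:
  "nodes_ok W hashcode s pre \<Longrightarrow> cnode_ok W hashcode s pre p cn \<Longrightarrow> replaces s pre p cn (NewCNode cn)"
  by (rule replaces_entries) (auto simp: cnode_ok_def intro: keep)

lemma replaces_Null:
  assumes "replaces s pre p cn (NewCNode cn')" "arr cn' = Map.empty"
  shows "replaces s pre p cn NewNull"
  using assms by (auto simp: replaces_def)

text \<open>A tomb answers for its key without looking at a chunk, the cnode only at chunk
  \<open>r\<close>. They agree because the key has prefix \<open>p @ [r]\<close>, so that its own
  chunk is \<open>r\<close>.\<close>

lemma replaces_singleton:
  assumes ok: "nodes_ok W hashcode s pre" and r: "replaces s pre p cn (NewCNode cn')"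
    and arr: "arr cn' = [r \<mapsto> b]"
    and b: "b = Leaf sn0 \<or> (\<exists>j. b = INode j \<and> inodes s j = Some (SNodeMain sn0))"
    and sn: "key sn = key sn0" "tomb sn"
  shows "replaces s pre p cn (NewSNode sn)"
proof -
  have cn': "cnode_ok W hashcode s pre p cn'" using r by (simp add: replaces_def)
  have "branch_ok W hashcode s pre (p @ [r]) b" using cnode_okD[OF cn'] arr by simp
  moreover have "has_prefix W hashcode (key sn0) (pre j)" if "inodes s j = Some (SNodeMain sn0)" for j
  proof -
    have "main_ok W hashcode s pre (pre j) (SNodeMain sn0)"
      using ok that unfolding nodes_ok_def by blast
    then show ?thesis by simp
  qed
  ultimately have pr: "has_prefix W hashcode (key sn) (p @ [r])"
    using b unfolding sn(1) branch_ok_def by (elim disjE exE conjE) (auto, metis)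
  then have r_eq: "r = chunk W hashcode (length p * W) (key sn)" by (simp add: has_prefix_snoc)
  have b_has: "branch_has W hashcode s l k (Some b) \<longleftrightarrow> key sn = k" for l k
    using b sn(1) by (auto simp: hasKey_inode_iff)
  have "fresh_has W hashcode s (length p * W) k (NewSNode sn) \<longleftrightarrow>
      fresh_has W hashcode s (length p * W) k (NewCNode cn')" for k
    using b_has[of "length p * W + W" k] r_eq by (cases "chunk W hashcode (length p * W) k = r") (auto simp: arr)
  \<comment> \<open>A live entry of \<open>cn\<close> would persist in \<open>cn'\<close>, whose
    only entry is a leaf or a nonlive inode.\<close>
  moreover have "\<not> (arr cn r = Some (INode j) \<and> live s j)" for r j
  proof
    assume "arr cn r = Some (INode j) \<and> live s j"
    moreover from this have "arr cn' r = Some (INode j)" using r by (simp add: replaces_def)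
    ultimately show False using b arr by (auto simp: live_def split: if_splits)
  qed
  ultimately show ?thesis using r sn pr by (simp add: replaces_def has_prefix_snoc)
qed

lemma replaces_map_entries:
  assumes ok: "nodes_ok W hashcode s pre" "cnode_ok W hashcode s pre p cn"
    and g: "\<And>b. entry_step s (Some b) (g b)"
  shows "replaces s pre p cn (NewCNode (map_entries g cn))"
proof (rule replaces_entries[OF ok])
  have wf: "wf_cnode cn" using ok(2) by (simp add: cnode_ok_def)
  show "wf_cnode (map_entries g cn)" using map_entries[OF wf] by blast
  show "entry_step s (arr cn r) (arr (map_entries g cn) r)" for r
    using g by (cases "arr cn r") (auto simp: map_entries[OF wf] intro: keep)
qed

lemma replaces_compressed:
  assumes ok: "nodes_ok W hashcode s pre" "cnode_ok W hashcode s pre p cn" and "observed s obs"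
  shows "replaces s pre p cn (compressed obs cn)"
proof -
  define g where "g = (\<lambda>b. if null_inode obs b then None else Some (resurrect obs b))"
  have "entry_step s (Some b) (g b)" for b
    using assms(3) by (simp add: g_def entry_step_null_inode entry_step_resurrect)
  then have r: "replaces s pre p cn (NewCNode (map_entries g cn))"
    by (rule replaces_map_entries[OF ok])
  then have "wf_cnode (map_entries g cn)" by (simp add: replaces_def cnode_ok_def)
  then have "replaces s pre p cn
      (if array (map_entries g cn) = [] then NewNull else NewCNode (map_entries g cn))"
    using r replaces_Null[OF r arr_empty] by simp
  then show ?thesis by (simp only: compressed_def Let_def g_def)
qed

text \<open>Dropping null-inodes is an entrywise change. A collapse that follows concerns a
  singleton, recognised by \<open>resurrect\<close> yielding a leaf, be it from an snode entry or
  from a tomb-inode.\<close>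

lemma replaces_toWeakTombed:
  assumes ok: "nodes_ok W hashcode s pre" "cnode_ok W hashcode s pre p cn" and obs: "observed s obs"
    and f: "toWeakTombed obs cn = Some f"
  shows "replaces s pre p cn f"
proof -
  define g where "g = (\<lambda>b. if null_inode obs b then None else Some b)"
  let ?cn = "map_entries g cn"
  have "entry_step s (Some b) (g b)" for b
    using obs by (simp add: g_def entry_step_null_inode keep)
  then have r: "replaces s pre p cn (NewCNode ?cn)"
    by (rule replaces_map_entries[OF ok])
  then have wf: "wf_cnode ?cn" by (simp add: replaces_def cnode_ok_def)
  have f: "Some f = (case array ?cn of [] \<Rightarrow> Some NewNull
      | [b] \<Rightarrow> (case resurrect obs b of
          Leaf sn \<Rightarrow> Some (NewSNode (SNode (key sn) (val sn) True)) | INode _ \<Rightarrow> Some (NewCNode ?cn))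
      | _ \<Rightarrow> None)"
    using f by (simp only: toWeakTombed_def Let_def g_def)
  consider "array ?cn = []" "f = NewNull"
    | b sn where "array ?cn = [b]" "resurrect obs b = Leaf sn" "f = NewSNode (SNode (key sn) (val sn) True)"
    | "f = NewCNode ?cn"
    using f by (auto split: list.splits branch.splits)
  then show ?thesis
  proof cases
    case 1
    then show ?thesis using replaces_Null[OF r arr_empty[OF wf]] by simp
  next
    case 2
    obtain q where q: "arr ?cn = [q \<mapsto> b]" using arr_singleton[OF wf 2(1)] .
    from obs 2(2) show ?thesis
    proof (rule resurrect_eq_Leaf)
      assume "b = Leaf sn"
      then show ?thesis using replaces_singleton[OF ok(1) r q] 2(3) by simp
    next
      fix j sn0 assume "b = INode j" "inodes s j = Some (SNodeMain sn0)" "key sn = key sn0"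
      then show ?thesis using replaces_singleton[OF ok(1) r q, of sn0] 2(3) by simp
    qed
  qed (use r in simp)
qed

text \<open>If the entry was the last one, an empty cnode results; it is well formed and holds no
  key.\<close>

lemma replaces_contract_null:
  assumes ok: "nodes_ok W hashcode s pre" "cnode_ok W hashcode s pre p cn"
    and "arr cn r = Some (INode i)" "inodes s i = Some Null"
  shows "replaces s pre p cn (NewCNode (removed cn r))"
proof -
  have "wf_cnode cn" "flg cn r" using assms by (auto simp: cnode_ok_def arr_def split: if_splits)
  then show ?thesis using assms
    by (intro replaces_entries[OF ok]) (auto simp: removed intro: keep drop)
qed

lemma replaces_contract_tomb:
  assumes ok: "nodes_ok W hashcode s pre" "cnode_ok W hashcode s pre p cn"
    and "arr cn r = Some (INode i)" "inodes s i = Some (SNodeMain sn)" "key sn' = key sn"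
  shows "replaces s pre p cn (NewCNode (updated cn r (Leaf sn')))"
proof -
  have "wf_cnode cn" "flg cn r" using assms by (auto simp: cnode_ok_def arr_def split: if_splits)
  then show ?thesis using assms
    by (intro replaces_entries[OF ok]) (auto simp: updated intro: keep entry_step.resurrect)
qed

end


subsection \<open>Program steps\<close>

text \<open>After the CAS of a removal only clean-up remains.\<close>

fun effected :: "('k, 'v) pc \<Rightarrow> bool" where
  "effected (TombCompress i p l w) \<longleftrightarrow> True"
| "effected (TombScan i p l w c obs) \<longleftrightarrow> True"
| "effected (TombCas i p l w c f) \<longleftrightarrow> True"
| "effected (Contract i p l w) \<longleftrightarrow> True"
| "effected (ContractParent i p l w mn) \<longleftrightarrow> True"
| "effected (ContractCas i p l w mn c) \<longleftrightarrow> True"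
| "effected (Return res) \<longleftrightarrow> True"
| "effected _ \<longleftrightarrow> False"

definition is_remove :: "('k, 'v) operation \<Rightarrow> bool" where
  "is_remove x \<longleftrightarrow> (\<exists>k. x = Remove k)"

section \<open>Assertions about program counters and their stability\<close>

context
  fixes W :: nat and hashcode :: "'k \<Rightarrow> nat"
begin

text \<open>Places \<open>i\<close> on the search path of the key by its prefix and leaves open
  whether \<open>i\<close> is still linked; this makes it stable.\<close>

definition visits ::
  "('k, 'v) store \<Rightarrow> (iref \<Rightarrow> nat list) \<Rightarrow> ('k, 'v) operation \<Rightarrow> iref \<Rightarrow> nat \<Rightarrow> bool" where
  "visits s pre x i l \<longleftrightarrow> i \<in> dom (inodes s) \<and> l = length (pre i) * W \<and>
     has_prefix W hashcode (op_key x) (pre i)"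

text \<open>What a thread may remember between two steps. A cnode reference is never claimed to be
  the current main field of an inode, as this is for the CAS to test; a main field is described only
  if it is not a cnode.\<close>

fun pc_ok ::
  "('k, 'v) store \<Rightarrow> (iref \<Rightarrow> nat list) \<Rightarrow> ('k, 'v) operation \<Rightarrow> ('k, 'v) pc \<Rightarrow> bool" where
  "pc_ok s pre x (TestRoot r) \<longleftrightarrow> r \<in> dom (inodes s) \<and> pre r = []"
| "pc_ok s pre x (CasRoot (Some r)) \<longleftrightarrow> inodes s r = Some Null"
| "pc_ok s pre x (Visit i l po) \<longleftrightarrow> visits s pre x i l"
| "pc_ok s pre x (InsertCas i c l) \<longleftrightarrow> visits s pre x i l"
| "pc_ok s pre x (RemoveCas i c l po) \<longleftrightarrow> visits s pre x i l \<and>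
     (\<exists>cn sn. cnodes s c = Some cn \<and> arr cn (chunk W hashcode l (op_key x)) = Some (Leaf sn) \<and>
        key sn = op_key x)"
| "pc_ok s pre x (CleanScan i c obs) \<longleftrightarrow> observed s obs"
| "pc_ok s pre x (CleanCas i c f) \<longleftrightarrow> (\<exists>cn. cnodes s c = Some cn \<and>
     ((\<exists>j sn. array cn = [INode j] \<and> inodes s j = Some (SNodeMain sn) \<and> tomb sn \<and> f = NewSNode sn) \<or>
      (\<exists>obs. observed s obs \<and> f = compressed obs cn)))"
| "pc_ok s pre x (TombCompress i p l w) \<longleftrightarrow> is_remove x"
| "pc_ok s pre x (TombScan i p l w c obs) \<longleftrightarrow> is_remove x \<and> observed s obs"
| "pc_ok s pre x (TombCas i p l w c f) \<longleftrightarrow> is_remove x \<and>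
     (\<exists>cn obs. cnodes s c = Some cn \<and> observed s obs \<and> toWeakTombed obs cn = Some f)"
| "pc_ok s pre x (Contract i p l w) \<longleftrightarrow> is_remove x"
| "pc_ok s pre x (ContractParent i p l w mn) \<longleftrightarrow> is_remove x \<and>
     ((\<forall>c. mn \<noteq> CNodeMain c) \<longrightarrow> inodes s i = Some mn)"
| "pc_ok s pre x (ContractCas i p l w mn c) \<longleftrightarrow> is_remove x \<and>
     (\<forall>c. mn \<noteq> CNodeMain c) \<and> inodes s i = Some mn \<and>
     (\<exists>cn. cnodes s c = Some cn \<and> arr cn (chunk W hashcode (l - W) (op_key x)) = Some (INode i))"
| "pc_ok s pre x _ \<longleftrightarrow> True"

lemma evolves_nonlive:
  "evolves s pre s' pre' \<Longrightarrow> inodes s i = Some mn \<Longrightarrow> (\<And>c. mn \<noteq> CNodeMain c) \<Longrightarrow> inodes s' i = Some mn"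
  by (auto simp: evolves_def live_def)

lemma observed_evolves: "observed s obs \<Longrightarrow> evolves s pre s' pre' \<Longrightarrow> observed s' obs"
  using evolves_nonlive unfolding observed_def by metis

lemma visits_evolves: "visits s pre x i l \<Longrightarrow> evolves s pre s' pre' \<Longrightarrow> visits s' pre' x i l"
  by (auto simp: visits_def evolves_def grows_def)

lemma evolves_cnodes: "evolves s pre s' pre' \<Longrightarrow> cnodes s c = Some cn \<Longrightarrow> cnodes s' c = Some cn"
  using grows_cnodes unfolding evolves_def by blast

text \<open>Interference freedom: allocated cnodes, ghost prefixes and main fields that are not
  cnodes are all preserved by \<open>evolves\<close>.\<close>

lemma pc_ok_evolves:
  assumes "pc_ok s pre x p" and e: "evolves s pre s' pre'"
  shows "pc_ok s' pre' x p"
proof -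
  have c: "cnodes s' c = Some cn" if "cnodes s c = Some cn" for c cn
    using evolves_cnodes[OF e that] .
  have sn: "inodes s' j = Some (SNodeMain sn)" if "inodes s j = Some (SNodeMain sn)" for j sn
    using evolves_nonlive[OF e that] by simp
  note o = observed_evolves[OF _ e] and v = visits_evolves[OF _ e] and nl = evolves_nonlive[OF e]
  show ?thesis
  proof (cases p)
    case (TestRoot r)
    then show ?thesis using assms by (auto simp: evolves_def grows_def)
  next
    case (CasRoot ro)
    then show ?thesis using assms(1) nl[of _ Null] by (cases ro) auto
  next
    case (RemoveCas i c l po)
    then show ?thesis using assms(1) c v by simp blast
  next
    case (CleanCas i c f)
    then obtain cn where "cnodes s c = Some cn"
      "(\<exists>j sn. array cn = [INode j] \<and> inodes s j = Some (SNodeMain sn) \<and> tomb sn \<and> f = NewSNode sn) \<or>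
       (\<exists>obs. observed s obs \<and> f = compressed obs cn)"
      using assms(1) by auto
    then have "cnodes s' c = Some cn"
      "(\<exists>j sn. array cn = [INode j] \<and> inodes s' j = Some (SNodeMain sn) \<and> tomb sn \<and> f = NewSNode sn) \<or>
       (\<exists>obs. observed s' obs \<and> f = compressed obs cn)"
      using c sn o by blast+
    then show ?thesis using CleanCas by simp
  next
    case (TombCas i p l w c f)
    then show ?thesis using assms(1) c o by simp blast
  next
    case (ContractParent i p l w mn)
    then show ?thesis using assms(1) nl[of i mn] by auto
  next
    case (ContractCas i p l w mn c)
    then show ?thesis using assms(1) nl[of i mn] c by simp blast
  qed (use assms(1) v o in auto)
qed


end

section \<open>Effects of single steps on the abstract set\<close>

context
  fixes W :: nat and hashcode :: "'k \<Rightarrow> nat"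
begin

text \<open>The linearization point is read off the program counter: it is the step that makes
  \<open>effected\<close> true. A lookup must have its result at this very step, since the abstract
  set may change right after it.\<close>

definition effect :: "('k, 'v) operation \<Rightarrow>
    ('k, 'v) store \<Rightarrow> ('k, 'v) pc \<Rightarrow> ('k, 'v) store \<Rightarrow> ('k, 'v) pc \<Rightarrow> bool" where
  "effect x s p s' p' \<longleftrightarrow> (effected p \<longrightarrow> effected p') \<and>
     (if \<not> effected p \<and> effected p'
      then (\<forall>k. abs_has W hashcode s' k \<longleftrightarrow> k \<in> abstract_op x {k. abs_has W hashcode s k}) \<and>
        (\<forall>k. x = Lookup k \<longrightarrow>
          (\<exists>res. p' = Return res \<and> ((\<exists>v. res = Found v) \<longleftrightarrow> abs_has W hashcode s k)))
      else (\<forall>k. abs_has W hashcode s' k = abs_has W hashcode s k))"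

definition step_ok :: "('k, 'v) operation \<Rightarrow> ('k, 'v) store \<Rightarrow> (iref \<Rightarrow> nat list) \<Rightarrow>
    ('k, 'v) pc \<Rightarrow> ('k, 'v) store \<Rightarrow> ('k, 'v) pc \<Rightarrow> bool" where
  "step_ok x s pre p s' p' \<longleftrightarrow> (\<exists>pre'. store_inv W hashcode s' pre' \<and> evolves s pre s' pre' \<and>
     pc_ok W hashcode s' pre' x p' \<and> effect x s p s' p')"

lemma evolves_refl: "evolves s pre s pre"
  by (simp add: evolves_def grows_def)

lemma step_ok_refl:
  assumes "store_inv W hashcode s pre" "pc_ok W hashcode s pre x p'" "effect x s p s p'"
  shows "step_ok x s pre p s p'"
  using assms evolves_refl unfolding step_ok_def by blast

lemma effect_silent: "effected p = effected p' \<Longrightarrow> effect x s p s p'"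
  by (simp add: effect_def)

lemma observed_update:
  "observed s obs \<Longrightarrow> inodes s j = Some mn \<Longrightarrow> observed s (obs(j \<mapsto> mn))"
  by (simp add: observed_def)

lemma step_ok_silent:
  assumes "store_inv W hashcode s pre" "s' = s" "pc_ok W hashcode s pre x p'" "effected p = effected p'"
  shows "step_ok x s pre p s' p'"
  using assms step_ok_refl effect_silent by blast

text \<open>An unsuccessful removal takes effect here too: deleting an absent key is the
  identity.\<close>

lemma effect_not_found:
  assumes "\<not> abs_has W hashcode s (op_key x)" "\<forall>k v. x \<noteq> Insert k v" "\<not> effected p"
  shows "effect x s p s (Return NotFound)"
  using assms by (cases x) (auto simp: effect_def)

lemma effect_found:
  assumes "abs_has W hashcode s k" "x = Lookup k" "\<not> effected p"
  shows "effect x s p s (Return (Found v))"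
  using assms by (auto simp: effect_def)

text \<open>Finding a cnode shows that \<open>i\<close> is live at this moment and hence linked, so
  the entry read decides membership of the key.\<close>

lemma abs_has_visit:
  assumes "store_inv W hashcode s pre" "visits W hashcode s pre x i l"
    and "inodes s i = Some (CNodeMain c)" "cnodes s c = Some cn"
  shows "abs_has W hashcode s (op_key x) \<longleftrightarrow>
    branch_has W hashcode s (l + W) (op_key x) (arr cn (chunk W hashcode l (op_key x)))"
proof -
  have "linked s pre i" using assms by (auto simp: store_inv_def live_def)
  then show ?thesis
    using abs_has_linked[OF assms(1)] assms by (simp add: visits_def hasKey_live)
qed

text \<open>Serves both kinds of successful CAS on the root. The old root is absent or a null-inode,
  so the old abstract set is empty and no live inode owes its link to being the root.\<close>

lemma inv_set_root:
  assumes inv: "store_inv W hashcode s pre"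
    and root: "root s = None \<or> (\<exists>r. root s = Some r \<and> inodes s r = Some Null)"
    and ext: "extends s pre s1 pre1" and ok1: "nodes_ok W hashcode s1 pre1"
    and ro: "\<And>r. ro = Some r \<Longrightarrow> r \<in> dom (inodes s1) \<and> pre1 r = []"
    and new: "\<And>j. live s1 j \<Longrightarrow> j \<notin> dom (inodes s) \<Longrightarrow> pre1 j = [] \<and> ro = Some j"
  shows "store_inv W hashcode (s1\<lparr>root := ro\<rparr>) pre1" "evolves s pre (s1\<lparr>root := ro\<rparr>) pre1"
    "\<not> abs_has W hashcode s k"
proof -
  let ?s = "s1\<lparr>root := ro\<rparr>"
  have g: "grows s1 pre1 ?s pre1" by (simp add: grows_def)
  have "nodes_ok W hashcode ?s pre1"
    unfolding nodes_ok_def using main_ok_grows[OF _ g] ok1 by (simp add: nodes_ok_def)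
  moreover have "linked ?s pre1 j" if "live ?s j" for j
  proof (cases "j \<in> dom (inodes s)")
    case True
    have eq: "inodes s1 m = inodes s m \<and> pre1 m = pre m" if "m \<in> dom (inodes s)" for m
      using ext that by (auto simp: extends_def grows_def map_le_def)
    have "live s j" using that True eq by (simp add: live_def)
    \<comment> \<open>An existing root has main field \<open>Null\<close>, so the live
      \<open>j\<close> has a parent link, and such links do not involve the root reference.\<close>
    then have "linked s pre j" "root s \<noteq> Some j" using inv root by (auto simp: store_inv_def live_def)
    then obtain i c cn r where i: "inodes s i = Some (CNodeMain c)" "cnodes s c = Some cn"
      "pre j = pre i @ [r]" "arr cn r = Some (INode j)" by (auto simp: linked_def linked_by_def)
    moreover have "cnodes ?s c = Some cn"
      using i(2) ext grows_cnodes by (fastforce simp: extends_def)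
    ultimately have "linked_by ?s pre1 i j"
      using eq[OF True] eq[OF domI[of "inodes s" i, OF i(1)]] by (auto simp: linked_by_def)
    then show ?thesis by (auto simp: linked_def)
  next
    case False
    then show ?thesis using new that by (auto simp: linked_def live_def)
  qed
  ultimately show "store_inv W hashcode ?s pre1" using ro by (simp add: store_inv_def)
  show "evolves s pre ?s pre1"
    using ext by (auto simp: extends_def evolves_def grows_def dest: map_leD)
  show "\<not> abs_has W hashcode s k"
    using root by (auto simp: abs_has_def hasKey_inode_iff)
qed

lemma step_ok_replaces:
  assumes "store_inv W hashcode s pre" "inodes s i = Some (CNodeMain c)" "cnodes s c = Some cn"
    and "cnode_ok W hashcode s pre (pre i) cn \<Longrightarrow> replaces W hashcode s pre (pre i) cn f"
    and "alloc_main s f s2 mn" "effected p = effected p'"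
    and "\<And>s'. pc_ok W hashcode s' pre x p'"
  shows "step_ok x s pre p (write_main s2 i mn) p'"
proof -
  have "cnode_ok W hashcode s pre (pre i) cn"
    using nodes_okD[of W hashcode s pre i c] assms(1-3) by (auto simp: store_inv_def)
  then have "replaces W hashcode s pre (pre i) cn f" using assms(4) by blast
  note r = replaces_write[OF assms(1-3) this assms(5)]
  have "effect x s p (write_main s2 i mn) p'" using r(3) assms(6) by (simp add: effect_def)
  then show ?thesis using r(1,2) assms(7) unfolding step_ok_def by blast
qed

text \<open>Inodes are allocated, and ghost prefixes extended, only in
  \<open>cas_root_insert\<close> and \<open>insert_success\<close>. Apart from
  \<open>insert_success\<close> and \<open>remove_success\<close>, overwriting a main field is
  clean-up and covered by \<open>step_ok_replaces\<close>. The cases left to the end only move the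
  program counter.\<close>

lemma exec_step_ok:
  assumes exec: "exec W hashcode x s p s' p'" and inv: "store_inv W hashcode s pre"
    and pc: "pc_ok W hashcode s pre x p"
  shows "step_ok x s pre p s' p'"
proof -
  have ok: "nodes_ok W hashcode s pre" using inv by (simp add: store_inv_def)
  have root: "r \<in> dom (inodes s) \<and> pre r = []" if "root s = Some r" for r
    using inv that by (simp add: store_inv_def)
  have cok: "cnode_ok W hashcode s pre (pre i) cn"
    if "inodes s i = Some (CNodeMain c)" "cnodes s c = Some cn" for i c cn
    using nodes_okD[OF ok that(1)] that by auto
  have new_alloc: "alloc_main s (NewCNode cn) s1 (CNodeMain c)" if "new_cnode s cn s1 c"
    for s s1 :: "('k, 'v) store" and cn c
    using that by (rule alloc_main.intros)
  from exec show ?thesis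
  proof cases
    case (root_null_other)
    then have "\<not> abs_has W hashcode s (op_key x)" by (simp add: abs_has_def)
    then show ?thesis
      using root_null_other inv by (intro step_ok_refl effect_not_found | simp)+
  next
    case (root_inode r)
    then show ?thesis using inv root by (intro step_ok_silent) simp_all
  next
    case (cas_root_insert ro k v s1 c s2 i)
    let ?cn = "CNode (2 ^ chunk W hashcode 0 k) [Leaf (SNode k v False)]"
    have cn: "cnode_ok W hashcode s pre [] ?cn"
      by (auto simp: cnode_ok_def single_cnode chunk_less has_prefix_def split: if_splits)
    have n: "grows s pre s1 pre" "nodes_ok W hashcode s1 pre" "inodes s1 = inodes s"
      "root s1 = root s" "cnodes s1 c = Some ?cn"
      using nodes_ok_new_cnode[OF ok] cas_root_insert by blast+
    have s2: "i \<notin> dom (inodes s)" "inodes s2 = (inodes s)(i \<mapsto> CNodeMain c)" "cnodes s2 = cnodes s1"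
      "root s2 = root s"
      using cas_root_insert n by (auto simp: new_inode_def)
    let ?pre = "pre(i := [])"
    have g: "grows s1 pre s2 ?pre" using s2 n by (auto simp: grows_def)
    have g2: "grows s pre s2 ?pre" using n(1) s2 by (auto simp: grows_def)
    have "main_ok W hashcode s2 ?pre (?pre j) m" if "inodes s2 j = Some m" for j m
    proof (cases "j = i")
      case True
      then have "m = CNodeMain c" using that s2 by simp
      then show ?thesis using True s2 n cnode_ok_grows[OF cn g2] by simp
    next
      case False
      then show ?thesis using that s2 main_ok_grows[OF _ g2] ok by (simp add: nodes_ok_def)
    qed
    then have ok2: "nodes_ok W hashcode s2 ?pre" by (simp add: nodes_ok_def)
    have ext: "extends s pre s2 ?pre" using g2 s2 by (auto simp: extends_def map_le_def)
    have rt: "root s = None \<or> (\<exists>r. root s = Some r \<and> inodes s r = Some Null)"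
      using cas_root_insert pc by (cases ro) auto
    have ro: "r \<in> dom (inodes s2) \<and> ?pre r = []" if "Some i = Some r" for r
      using that s2 by simp
    have new: "?pre j = [] \<and> Some i = Some j" if "live s2 j" "j \<notin> dom (inodes s)" for j
      using that s2 by (auto simp: live_def split: if_splits)
    have "store_inv W hashcode s' ?pre" "evolves s pre s' ?pre" "\<not> abs_has W hashcode s k'" for k'
      unfolding cas_root_insert(2) by (rule inv_set_root[OF inv rt ext ok2 ro new]; assumption)+
    \<comment> \<open>The old abstract set is empty, so the set of \<open>k\<close> alone is the
      required union.\<close>
    moreover have "abs_has W hashcode s' k' \<longleftrightarrow> k' = k" for k'
      using s2 n cas_root_insert(2)
      by (auto simp: abs_has_def hasKey_inode_iff hasKey_cnode_iff single_cnode split: if_splits)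
    ultimately show ?thesis
      using cas_root_insert(1,3,5) unfolding step_ok_def effect_def by auto
  next
    case (cas_root_other ro)
    have rt: "root s = None \<or> (\<exists>r. root s = Some r \<and> inodes s r = Some Null)"
      using cas_root_other pc by (cases ro) auto
    have ro: "r \<in> dom (inodes s) \<and> pre r = []" if "None = Some r" for r
      using that by simp
    have new: "pre j = [] \<and> None = Some j" if "live s j" "j \<notin> dom (inodes s)" for j
      using that by (auto simp: live_def)
    have "store_inv W hashcode s' pre" "evolves s pre s' pre" "\<not> abs_has W hashcode s k" for k
      unfolding cas_root_other(2) by (rule inv_set_root[OF inv rt extends_refl ok ro new]; assumption)+
    moreover have "\<not> abs_has W hashcode s' k" for k using cas_root_other by (simp add: abs_has_def)
    ultimately show ?thesis using cas_root_other unfolding step_ok_def effect_def by auto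
  next
    case (visit_inode i c cn l j po)
    then have "cnode_ok W hashcode s pre (pre i) cn" using cok by simp
    with visit_inode have "j \<in> dom (inodes s)" "pre j = pre i @ [chunk W hashcode l (op_key x)]"
      using cnode_okD by (fastforce simp: sub_eq_arr)+
    then have "visits W hashcode s pre x j (l + W)"
      using pc visit_inode by (auto simp: visits_def has_prefix_snoc add.commute)
    then show ?thesis using visit_inode inv by (intro step_ok_silent) simp_all
  next
    case (visit_unset i c cn l po)
    then have "\<not> abs_has W hashcode s (op_key x)"
      using abs_has_visit[OF inv _ visit_unset(4,5), of x l] pc by (simp add: arr_def)
    then show ?thesis
      using visit_unset inv by (intro step_ok_refl effect_not_found | simp)+
  next
    case (visit_other_key i c cn l sn po)
    then have "\<not> abs_has W hashcode s (op_key x)"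
      using abs_has_visit[OF inv _ visit_other_key(4,5), of x l] pc by (simp add: sub_eq_arr)
    then show ?thesis
      using visit_other_key inv by (intro step_ok_refl effect_not_found | simp)+
  next
    case (visit_lookup i c cn k l sn po)
    then have "abs_has W hashcode s k"
      using abs_has_visit[OF inv _ visit_lookup(4,5), of x l] pc by (simp add: sub_eq_arr)
    then show ?thesis
      using visit_lookup inv by (intro step_ok_refl effect_found[of s k] | simp)+
  next
    case (insert_success i c cn k v l s1 cn' s2 c')
    have l: "l = length (pre i) * W" and k: "has_prefix W hashcode k (pre i)"
      using pc insert_success by (auto simp: visits_def)
    note cp = insert_copy[OF insert_success(7) ok cok[OF insert_success(4,5)] l k]
    obtain pre1 where sp: "sprouts W hashcode s pre (pre i) s1 pre1 cn'" using cp(1) by blast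
    then have ext: "extends s pre s1 pre1" and ok1: "nodes_ok W hashcode s1 pre1"
      and cn': "fresh_ok W hashcode s1 pre1 (pre i) (NewCNode cn')"
      and new: "\<And>j. live s1 j \<Longrightarrow> j \<notin> dom (inodes s) \<Longrightarrow>
        (\<exists>j'. j' \<notin> dom (inodes s) \<and> linked_by s1 pre1 j' j) \<or>
        (\<exists>r. pre1 j = pre i @ [r] \<and> fresh_arr (NewCNode cn') r = Some (INode j))"
      by (simp_all add: sprouts_def)
    have keep: "fresh_arr (NewCNode cn') r = Some (INode j)" if "arr cn r = Some (INode j)" for r j
      using cp(2) that by simp
    note w = write_main[OF inv insert_success(4,5) ext ok1 new cn'
        new_alloc[OF insert_success(8)] keep]
    have "abs_has W hashcode s' k' \<longleftrightarrow> abs_has W hashcode s k' \<or> k' = k" for k'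
    proof (cases "has_prefix W hashcode k' (pre i)")
      case True
      then show ?thesis using w(3)[of k'] w(4)[of k'] cp(3)[of k'] l insert_success(2) by simp
    next
      case False
      then have "k' \<noteq> k" using k by blast
      then show ?thesis using w(3)[of k'] False insert_success(2) by simp
    qed
    moreover have "store_inv W hashcode s' pre1" "evolves s pre s' pre1"
      using w(1,2) insert_success(2) by blast+
    ultimately show ?thesis using insert_success unfolding step_ok_def effect_def by auto
  next
    case (remove_success i c cn k l sn s1 mn po)
    let ?f = "if length (array cn) = 1 then NewNull else NewCNode (removed cn (chunk W hashcode l k))"
    let ?r = "chunk W hashcode l k"
    have l: "l = length (pre i) * W" and k: "has_prefix W hashcode k (pre i)"
      using pc remove_success by (auto simp: visits_def)
    have cn: "cnode_ok W hashcode s pre (pre i) cn" using cok remove_success by blast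
    then have wf: "wf_cnode cn" by (simp add: cnode_ok_def)
    have sn: "arr cn ?r = Some (Leaf sn)" "key sn = k"
      using remove_success pc by (auto simp: sub_eq_arr)
    then have flg: "flg cn ?r" by (auto simp: arr_def split: if_splits)
    note rem = removed[OF wf flg]
    \<comment> \<open>With a single cell the removed entry is the only one, so
      \<open>NewNull\<close> has the same (empty) partial map as the cnode without that entry. Both
      branches of \<open>?f\<close> can then be treated alike.\<close>
    have single: "arr cn = [?r \<mapsto> Leaf sn]" if "length (array cn) = 1"
    proof -
      obtain b where "array cn = [b]" using \<open>length (array cn) = 1\<close> by (auto simp: length_Suc_conv)
      then obtain q where "arr cn = [q \<mapsto> b]" using arr_singleton[OF wf] by blast
      then show ?thesis using sn(1) by (auto split: if_splits)
    qed
    have f_arr: "fresh_arr ?f r = ((arr cn)(?r := None)) r" for r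
      using single rem(2) by auto
    have fok: "fresh_ok W hashcode s pre (pre i) ?f"
      using cn rem by (auto simp: cnode_ok_def)
    \<comment> \<open>At the chunk of \<open>k\<close> the old cnode holds the key \<open>k\<close>
      and no other, so clearing this entry removes just \<open>k\<close>.\<close>
    have f_has: "fresh_has W hashcode s l k' ?f \<longleftrightarrow>
        fresh_has W hashcode s l k' (NewCNode cn) \<and> k' \<noteq> k" for k'
    proof (cases "chunk W hashcode l k' = ?r")
      case True
      then show ?thesis using sn rem(2) by auto
    next
      case False
      then show ?thesis using single rem(2) by auto
    qed
    have new: "(\<exists>j'. j' \<notin> dom (inodes s) \<and> linked_by s pre j' j) \<or>
        (\<exists>r. pre j = pre i @ [r] \<and> fresh_arr ?f r = Some (INode j))"
      if "live s j" "j \<notin> dom (inodes s)" for j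
      using that by (auto simp: live_def)
    have keep: "fresh_arr ?f r = Some (INode j)" if "arr cn r = Some (INode j)" for r j
      using that sn(1) unfolding f_arr by auto
    note w = write_main[OF inv remove_success(4,5) extends_refl ok new fok remove_success(8) keep]
    have "abs_has W hashcode s' k' \<longleftrightarrow> abs_has W hashcode s k' \<and> k' \<noteq> k" for k'
    proof (cases "has_prefix W hashcode k' (pre i)")
      case True
      then show ?thesis using w(3)[of k'] w(4)[of k'] f_has[of k'] l remove_success(2) by simp
    next
      case False
      then have "k' \<noteq> k" using k by blast
      then show ?thesis using w(3)[of k'] False remove_success(2) by simp
    qed
    moreover have "store_inv W hashcode s' pre" "evolves s pre s' pre"
      using w(1,2) remove_success(2) by blast+
    \<comment> \<open>With a parent the clean-up follows, without one the operation returns; both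
      program counters count as effected, so this CAS is the linearization point.\<close>
    moreover have "effected p'" "pc_ok W hashcode s' pre x p'"
      using remove_success by (auto simp: is_remove_def split: option.splits)
    ultimately show ?thesis
      using remove_success(1,6) unfolding step_ok_def effect_def by auto
  next
    case (visit_remove i c cn k l sn po)
    then have "pc_ok W hashcode s pre x p'" using pc by (auto simp: sub_eq_arr)
    then show ?thesis using visit_remove inv by (intro step_ok_silent) simp_all
  next
    case (clean_success i c f s1 mn)
    obtain cn where cn: "cnodes s c = Some cn"
      "(\<exists>j sn. array cn = [INode j] \<and> inodes s j = Some (SNodeMain sn) \<and> tomb sn \<and> f = NewSNode sn) \<or>
      (\<exists>obs. observed s obs \<and> f = compressed obs cn)"
      using pc clean_success(1) by auto
    have "replaces W hashcode s pre (pre i) cn f" if c: "cnode_ok W hashcode s pre (pre i) cn"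
      using cn(2)
    proof (elim disjE exE conjE)
      fix j sn assume a: "array cn = [INode j]" "inodes s j = Some (SNodeMain sn)" "tomb sn" "f = NewSNode sn"
      have "wf_cnode cn" using c by (simp add: cnode_ok_def)
      then obtain r where "arr cn = [r \<mapsto> INode j]" using a(1) by (rule arr_singleton)
      then show ?thesis using replaces_singleton[OF ok replaces_refl[OF ok c]] a by simp
    next
      fix obs assume "observed s obs" "f = compressed obs cn"
      then show ?thesis using replaces_compressed[OF ok c] by simp
    qed
    from step_ok_replaces[OF inv clean_success(4) cn(1) this clean_success(5)]
    show ?thesis using clean_success by simp
  next
    case (tomb_success i c f s1 mn p2 l w)
    obtain cn obs where cn: "cnodes s c = Some cn" "observed s obs" "toWeakTombed obs cn = Some f"
      and x: "is_remove x"
      using pc tomb_success(1) by auto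
    have "replaces W hashcode s pre (pre i) cn f" if "cnode_ok W hashcode s pre (pre i) cn"
      using replaces_toWeakTombed[OF ok that] cn by blast
    from step_ok_replaces[OF inv tomb_success(4) cn(1) this tomb_success(5)]
    show ?thesis using tomb_success x by (simp split: fresh.splits)
  next
    case (contract_go p2 c cn l i mn w)
    then have "pc_ok W hashcode s pre x p'" using pc by (auto simp: sub_eq_arr)
    then show ?thesis using contract_go inv by (intro step_ok_silent) simp_all
  next
    case (contract_null p2 c cn l s1 c' i w)
    have "replaces W hashcode s pre (pre p2) cn (NewCNode (removed cn (chunk W hashcode (l - W) (op_key x))))"
      if "cnode_ok W hashcode s pre (pre p2) cn"
      using pc contract_null by (intro replaces_contract_null[OF ok that, of _ i]) auto
    from step_ok_replaces[OF inv contract_null(4,5) this new_alloc[OF contract_null(6)]]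
    show ?thesis using contract_null by simp
  next
    case (contract_tomb p2 c cn l sn s1 c' i w)
    have "replaces W hashcode s pre (pre p2) cn
        (NewCNode (updated cn (chunk W hashcode (l - W) (op_key x)) (Leaf (SNode (key sn) (val sn) False))))"
      if "cnode_ok W hashcode s pre (pre p2) cn"
      using pc contract_tomb by (intro replaces_contract_tomb[OF ok that, of _ i sn]) auto
    from step_ok_replaces[OF inv contract_tomb(4,5) this new_alloc[OF contract_tomb(6)]]
    show ?thesis using contract_tomb by simp
  next
    case (clean_scan c cn j obs mn i)
    then show ?thesis using pc by (intro step_ok_silent[OF inv]) (auto intro: observed_update)
  next
    case (clean_scan_done c cn obs i)
    then have "observed s obs" using pc by simp
    then show ?thesis using clean_scan_done by (intro step_ok_silent[OF inv]) auto
  next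
    case (tomb_scan c cn j obs mn i p2 l w)
    then show ?thesis using pc by (intro step_ok_silent[OF inv]) (auto intro: observed_update)
  next
    case (tomb_scan_changed c cn obs f i p2 l w)
    then have "pc_ok W hashcode s pre x p'" using pc by auto
    then show ?thesis using tomb_scan_changed by (intro step_ok_silent[OF inv]) simp_all
  next
    case (clean_single_tomb c cn j sn i)
    then have "pc_ok W hashcode s pre x p'" by auto
    then show ?thesis using clean_single_tomb by (intro step_ok_silent[OF inv]) simp_all
  qed (rule step_ok_silent[OF inv]; use pc in
      \<open>auto simp: visits_def has_prefix_Nil observed_def is_remove_def\<close>)+
qed

end


subsection \<open>Executions\<close>

text \<open>Witness for the set \<open>L\<close> of linearization points.\<close>

definition effect_times :: "(nat \<Rightarrow> ('t, 'k, 'v) config) \<Rightarrow>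
    (nat \<Rightarrow> ('t \<times> ('k, 'v) event) option) \<Rightarrow> nat set" where
  "effect_times \<sigma> ev = {n. \<exists>t x p p'. ev n = Some (t, Internal) \<and> threads (\<sigma> n) t = Busy x p \<and>
     threads (\<sigma> (Suc n)) t = Busy x p' \<and> \<not> effected p \<and> effected p'}"

section \<open>Validity, and invariance for all threads together\<close>

context
  fixes W :: nat and hashcode :: "'k \<Rightarrow> nat"
begin

text \<open>Connects the local invariant with reachability: the ghost prefix agrees with the chunks
  along every path from the root.\<close>

lemma inode_at_pre:
  assumes "store_inv W hashcode s pre"
  shows "inode_at W s i l p \<Longrightarrow> i \<in> dom (inodes s) \<and> pre i = p"
    and "cnode_at W s c l p \<Longrightarrow> \<exists>i. inodes s i = Some (CNodeMain c) \<and> pre i = p"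
proof (induction rule: inode_at_cnode_at.inducts)
  case (1 i)
  then show ?case using assms by (simp add: store_inv_def)
next
  case (2 i l p c)
  then show ?case by blast
next
  case (3 c l p cn r i)
  then obtain j where j: "inodes s j = Some (CNodeMain c)" "pre j = p" by blast
  have "cnode_ok W hashcode s pre p cn"
    using nodes_okD[OF _ j(1), of W hashcode pre] assms 3 j(2) by (auto simp: store_inv_def)
  then show ?case using 3 cnode_okD(2)[of W hashcode s pre p cn r "INode i"] by simp
qed

lemma inv_valid:
  assumes inv: "store_inv W hashcode s pre"
  shows "valid W hashcode s"
proof -
  have mn: "main_ok W hashcode s pre p mn" if "inode_at W s i l p" "inodes s i = Some mn" for i l p mn
    using inode_at_pre(1)[OF inv that(1)] that(2) inv by (auto simp: store_inv_def nodes_ok_def)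
  have cn: "cnode_ok W hashcode s pre p cn" if "cnode_at W s c l p" "cnodes s c = Some cn" for c l p cn
  proof -
    from inode_at_pre(2)[OF inv that(1)] obtain i where
      i: "inodes s i = Some (CNodeMain c)" "pre i = p" by blast
    show ?thesis
      using nodes_okD[OF _ i(1), of W hashcode pre] inv that(2) i(2) by (auto simp: store_inv_def)
  qed
  have "INV1 W s"
    unfolding INV1_def
  proof (intro allI impI)
    fix i l p assume i: "inode_at W s i l p"
    obtain m where m: "inodes s i = Some m" using inode_at_pre(1)[OF inv i] by auto
    show "inodes s i = Some Null \<or> (\<exists>c. inodes s i = Some (CNodeMain c) \<and> cnode_at W s c l p) \<or>
        (\<exists>sn. inodes s i = Some (SNodeMain sn) \<and> tomb sn)"
      using mn[OF i m] m i by (cases m) (auto intro: inode_at_cnode_at.intros)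
  qed
  moreover have "INV2 W s" using cn by (auto simp: INV2_def cnode_ok_def wf_cnode_def)
  moreover have "INV3 W s"
    unfolding INV3_def
  proof (intro allI impI, elim conjE)
    fix c l p d and r :: nat assume c: "cnode_at W s c l p" "cnodes s c = Some d" and r: "r < 2 ^ W"
    have "wf_cnode d" using cn[OF c] by (simp add: cnode_ok_def)
    then have "flg d r \<longleftrightarrow> (\<exists>b. arr d r = Some b)" by (auto simp: arr_wf)
    also have "\<dots> \<longleftrightarrow> (\<exists>sn. arr d r = Some (Leaf sn)) \<or> (\<exists>i. arr d r = Some (INode i))"
      by (metis branch.exhaust)
    \<comment> \<open>An inode entry of a reachable cnode is itself reachable, at the next
      level.\<close>
    also have "(\<exists>i. arr d r = Some (INode i)) \<longleftrightarrow>
        (\<exists>i. arr d r = Some (INode i) \<and> inode_at W s i (l + W) (p @ [r]))"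
      using c r by (blast intro: inode_at_cnode_at.intros)
    finally show "flg d r \<longleftrightarrow> (\<exists>sn. arr d r = Some (Leaf sn)) \<or>
        (\<exists>i. arr d r = Some (INode i) \<and> inode_at W s i (l + W) (p @ [r]))" .
  qed
  moreover have "INV4 W hashcode s"
    using cn cnode_okD(2) unfolding INV4_def by (metis branch_ok_simps(1))
  moreover have "INV5 W hashcode s"
    using mn unfolding INV5_def by (metis main_ok.simps(2))
  ultimately show ?thesis by (simp add: valid_def)
qed

definition config_ok :: "('t, 'k, 'v) config \<Rightarrow> bool" where
  "config_ok C \<longleftrightarrow> (\<exists>pre. store_inv W hashcode (mem C) pre \<and>
     (\<forall>t x p. threads C t = Busy x p \<longrightarrow> pc_ok W hashcode (mem C) pre x p))"

lemma config_ok_initial: "config_ok initial"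
  by (auto simp: config_ok_def initial_def store_inv_def nodes_ok_def live_def)

text \<open>Rely-guarantee composition: the acting thread gets its new assertion from
  \<open>exec_step_ok\<close>, all others keep theirs by \<open>pc_ok_evolves\<close>.\<close>

lemma config_ok_internal:
  assumes "config_ok C" "threads C t = Busy x p" "exec W hashcode x (mem C) p s' p'"
  shows "config_ok (C\<lparr>mem := s', threads := (threads C)(t := Busy x p')\<rparr>)"
    and "effect W hashcode x (mem C) p s' p'"
proof -
  obtain pre where pre: "store_inv W hashcode (mem C) pre"
    "\<And>t x p. threads C t = Busy x p \<Longrightarrow> pc_ok W hashcode (mem C) pre x p"
    using assms(1) by (auto simp: config_ok_def)
  from exec_step_ok[OF assms(3) pre(1) pre(2)[OF assms(2)]]
  obtain pre' where pre': "store_inv W hashcode s' pre'" "evolves (mem C) pre s' pre'"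
    "pc_ok W hashcode s' pre' x p'" "effect W hashcode x (mem C) p s' p'"
    unfolding step_ok_def by blast
  then show "config_ok (C\<lparr>mem := s', threads := (threads C)(t := Busy x p')\<rparr>)"
    using pc_ok_evolves[OF pre(2)] unfolding config_ok_def by auto
  show "effect W hashcode x (mem C) p s' p'" using pre' by blast
qed

lemma config_ok_step:
  assumes "step W hashcode C t e C'" "config_ok C"
  shows "config_ok C'"
  using assms
proof cases
  case (invoke x)
  then show ?thesis using assms(2) unfolding config_ok_def by (auto split: if_splits)
next
  case (internal x p s' p')
  then show ?thesis using config_ok_internal[OF assms(2)] by blast
next
  case (respond x res)
  then show ?thesis using assms(2) unfolding config_ok_def by (auto split: if_splits)
qed

context
  fixes \<sigma> :: "nat \<Rightarrow> ('t, 'k, 'v) config" and ev :: "nat \<Rightarrow> ('t \<times> ('k, 'v) event) option"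
  assumes execution: "execution W hashcode \<sigma> ev"
begin

lemma execution_step: "ev n = Some (t, e) \<Longrightarrow> step W hashcode (\<sigma> n) t e (\<sigma> (Suc n))"
  using execution unfolding execution_def by (metis (mono_tags, lifting) case_prod_conv option.simps(5))

lemma execution_idle: "ev n = None \<Longrightarrow> \<sigma> (Suc n) = \<sigma> n"
  using execution unfolding execution_def by (metis (mono_tags, lifting) option.simps(4))

lemma execution_config_ok: "config_ok (\<sigma> n)"
proof (induction n)
  case 0
  then show ?case using execution config_ok_initial by (simp add: execution_def)
next
  case (Suc n)
  then show ?case
    using execution_idle[of n] execution_step[of n] config_ok_step by (cases "ev n") auto
qed

lemma execution_other:
  assumes "\<And>e. ev n \<noteq> Some (t, e)"
  shows "threads (\<sigma> (Suc n)) t = threads (\<sigma> n) t"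
proof (cases "ev n")
  case None
  then show ?thesis by (simp add: execution_idle)
next
  case (Some te)
  obtain t' e where te: "te = (t', e)" by fastforce
  then have "t' \<noteq> t" using assms Some by blast
  with execution_step[OF Some[unfolded te]] show ?thesis by cases simp_all
qed

lemma execution_invoke:
  assumes "ev n = Some (t, Invoke x)"
  shows "threads (\<sigma> n) t = Idle" "threads (\<sigma> (Suc n)) t = Busy x ReadRoot" "mem (\<sigma> (Suc n)) = mem (\<sigma> n)"
proof -
  from execution_step[OF assms]
  have "threads (\<sigma> n) t = Idle \<and> threads (\<sigma> (Suc n)) t = Busy x ReadRoot \<and> mem (\<sigma> (Suc n)) = mem (\<sigma> n)"
    by cases simp_all
  then show "threads (\<sigma> n) t = Idle" "threads (\<sigma> (Suc n)) t = Busy x ReadRoot"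
    "mem (\<sigma> (Suc n)) = mem (\<sigma> n)" by blast+
qed

lemma execution_respond:
  assumes "ev n = Some (t, Respond res)"
  shows "\<exists>x. threads (\<sigma> n) t = Busy x (Return res)" "threads (\<sigma> (Suc n)) t = Idle"
    "mem (\<sigma> (Suc n)) = mem (\<sigma> n)"
proof -
  from execution_step[OF assms]
  have "(\<exists>x. threads (\<sigma> n) t = Busy x (Return res)) \<and> threads (\<sigma> (Suc n)) t = Idle \<and>
      mem (\<sigma> (Suc n)) = mem (\<sigma> n)"
    by cases simp_all
  then show "\<exists>x. threads (\<sigma> n) t = Busy x (Return res)" "threads (\<sigma> (Suc n)) t = Idle"
    "mem (\<sigma> (Suc n)) = mem (\<sigma> n)" by blast+
qed

lemma execution_internal:
  assumes "ev n = Some (t, Internal)"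
  obtains x p p' where "threads (\<sigma> n) t = Busy x p" "threads (\<sigma> (Suc n)) t = Busy x p'"
    "exec W hashcode x (mem (\<sigma> n)) p (mem (\<sigma> (Suc n))) p'"
    "effect W hashcode x (mem (\<sigma> n)) p (mem (\<sigma> (Suc n))) p'"
  using execution_step[OF assms]
proof cases
  case (internal x p s' p')
  then show thesis
    using that[of x p p'] config_ok_internal(2)[OF execution_config_ok[of n] internal(2,3)] by simp
qed

lemma no_effect_unchanged:
  assumes "n \<notin> effect_times \<sigma> ev"
  shows "abs_has W hashcode (mem (\<sigma> (Suc n))) k = abs_has W hashcode (mem (\<sigma> n)) k"
proof (cases "ev n")
  case None
  then show ?thesis by (simp add: execution_idle)
next
  case (Some te)
  obtain t e where te: "te = (t, e)" by fastforce
  show ?thesis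
  proof (cases e)
    case (Invoke x)
    then show ?thesis using execution_invoke Some te by metis
  next
    case (Respond res)
    then show ?thesis using execution_respond Some te by metis
  next
    case Internal
    then have i: "ev n = Some (t, Internal)" using Some te by simp
    then obtain x p p' where "threads (\<sigma> n) t = Busy x p" "threads (\<sigma> (Suc n)) t = Busy x p'"
      "effect W hashcode x (mem (\<sigma> n)) p (mem (\<sigma> (Suc n))) p'"
      by (rule execution_internal)
    moreover from this have "\<not> (\<not> effected p \<and> effected p')"
      using assms i by (auto simp: effect_times_def)
    ultimately show ?thesis by (simp add: effect_def)
  qed
qed

section \<open>Linearization points of operations\<close>

lemma invocation:
  assumes "threads (\<sigma> n) t = Busy x p"
  shows "\<exists>a < n. ev a = Some (t, Invoke x) \<and> (\<forall>j res. a < j \<and> j < n \<longrightarrow> ev j \<noteq> Some (t, Respond res))"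
  using assms
proof (induction n arbitrary: p)
  case 0
  then show ?case using execution by (simp add: execution_def initial_def)
next
  case (Suc n)
  have before: ?case if "threads (\<sigma> n) t = Busy x q" "\<And>res. ev n \<noteq> Some (t, Respond res)" for q
    using Suc.IH[OF that(1)] that(2) by (metis less_Suc_eq)
  show ?case
  proof (cases "\<exists>e. ev n = Some (t, e)")
    case False
    then show ?thesis using before[of p] execution_other[of n t] Suc.prems by simp
  next
    case True
    then obtain e where e: "ev n = Some (t, e)" ..
    show ?thesis
    proof (cases e)
      case (Invoke y)
      then have "ev n = Some (t, Invoke x)"
        using execution_invoke(2)[of n t y] e Suc.prems by simp
      then show ?thesis by (intro exI[of _ n]) auto
    next
      case Internal
      then have i: "ev n = Some (t, Internal)" using e by simp
      then obtain y q q' where "threads (\<sigma> n) t = Busy y q" "threads (\<sigma> (Suc n)) t = Busy y q'"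
        by (rule execution_internal)
      then show ?thesis using before[of q] Suc.prems i by simp
    next
      case (Respond res)
      then show ?thesis using execution_respond(2)[of n t res] e Suc.prems by simp
    qed
  qed
qed

text \<open>While an operation is pending, \<open>effected\<close> records whether its linearization
  point has passed. This gives existence of that point at the return as well as its uniqueness; for
  lookups the result is carried along.\<close>

lemma pending:
  assumes "ev a = Some (t, Invoke x)" "a < m"
    and "\<forall>j res. a < j \<and> j < m \<longrightarrow> ev j \<noteq> Some (t, Respond res)"
  shows "\<exists>p. threads (\<sigma> m) t = Busy x p \<and>
     (effected p \<longrightarrow> (\<exists>n \<in> effect_times \<sigma> ev \<inter> steps_of ev t a. n < m \<and>
        (\<forall>k. x = Lookup k \<longrightarrow> (\<exists>res. p = Return res \<and>
           ((\<exists>v. res = Found v) \<longleftrightarrow> abs_has W hashcode (mem (\<sigma> n)) k))))) \<and>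
     (\<forall>n \<in> effect_times \<sigma> ev \<inter> steps_of ev t a. n < m \<longrightarrow> effected p)"
  using assms(2,3)
proof (induction m)
  case (Suc m)
  show ?case
  proof (cases "m = a")
    case True
    have "n < Suc a \<Longrightarrow> n \<notin> steps_of ev t a" for n by (simp add: steps_of_def)
    then show ?thesis using execution_invoke(2)[OF assms(1)] True
      by (intro exI[of _ ReadRoot]) auto
  next
    case False
    then have am: "a < m" using Suc.prems(1) by simp
    have "\<forall>j res. a < j \<and> j < m \<longrightarrow> ev j \<noteq> Some (t, Respond res)" using Suc.prems(2) by simp
    from Suc.IH[OF am this] obtain p where p: "threads (\<sigma> m) t = Busy x p"
      and eff': "effected p \<longrightarrow> (\<exists>n \<in> effect_times \<sigma> ev \<inter> steps_of ev t a. n < m \<and>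
        (\<forall>k. x = Lookup k \<longrightarrow> (\<exists>res. p = Return res \<and>
           ((\<exists>v. res = Found v) \<longleftrightarrow> abs_has W hashcode (mem (\<sigma> n)) k))))"
      and noeff': "\<forall>n \<in> effect_times \<sigma> ev \<inter> steps_of ev t a. n < m \<longrightarrow> effected p"
      by (elim exE conjE)
    note eff = eff'[THEN mp] and noeff = noeff'[THEN bspec, THEN mp]
    show ?thesis
    proof (cases "ev m = Some (t, Internal)")
      case True
      then obtain q p' where "threads (\<sigma> m) t = Busy q p" "threads (\<sigma> (Suc m)) t = Busy q p'"
        "exec W hashcode q (mem (\<sigma> m)) p (mem (\<sigma> (Suc m))) p'"
        "effect W hashcode q (mem (\<sigma> m)) p (mem (\<sigma> (Suc m))) p'"
        using p by (elim execution_internal) simp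
      then have p': "threads (\<sigma> (Suc m)) t = Busy x p'"
        "exec W hashcode x (mem (\<sigma> m)) p (mem (\<sigma> (Suc m))) p'"
        "effect W hashcode x (mem (\<sigma> m)) p (mem (\<sigma> (Suc m))) p'"
        using p by simp_all
      have mono: "effected p \<Longrightarrow> effected p'" using p'(3) by (simp add: effect_def)
      have here: "effected p'" if "m \<in> effect_times \<sigma> ev"
        using that True p p'(1) by (auto simp: effect_times_def)
      \<comment> \<open>No internal step starts at \<open>Return\<close>; so an operation that is
        already effected and still moves is not a lookup, and no recorded result gets lost.\<close>
      have no_return: "p \<noteq> Return res" for res
      proof
        assume "p = Return res"
        with p'(2) show False by cases simp_all
      qed
      have found: "\<exists>n \<in> effect_times \<sigma> ev \<inter> steps_of ev t a. n < Suc m \<and>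
        (\<forall>k. x = Lookup k \<longrightarrow> (\<exists>res. p' = Return res \<and>
           ((\<exists>v. res = Found v) \<longleftrightarrow> abs_has W hashcode (mem (\<sigma> n)) k)))" if "effected p'"
      proof (cases "effected p")
        case True
        then obtain n where "n \<in> effect_times \<sigma> ev \<inter> steps_of ev t a" "n < m" "\<forall>k. x \<noteq> Lookup k"
          using eff[OF True] no_return by metis
        then show ?thesis by (intro bexI[of _ n]) simp_all
      next
        case False
        then have "m \<in> effect_times \<sigma> ev" using \<open>effected p'\<close> \<open>ev m = _\<close> p p'(1)
          by (auto simp: effect_times_def)
        moreover have "m \<in> steps_of ev t a" using am \<open>ev m = _\<close> Suc.prems by (auto simp: steps_of_def)
        moreover have "\<forall>k. x = Lookup k \<longrightarrow> (\<exists>res. p' = Return res \<and>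
           ((\<exists>v. res = Found v) \<longleftrightarrow> abs_has W hashcode (mem (\<sigma> m)) k))"
          using False \<open>effected p'\<close> p'(3) unfolding effect_def by simp
        ultimately show ?thesis by (intro bexI[of _ m]) simp_all
      qed
      have none: "effected p'" if "n \<in> effect_times \<sigma> ev \<inter> steps_of ev t a" "n < Suc m" for n
        using noeff[OF that(1)] that mono here by (cases "n = m") auto
      show ?thesis
        by (intro exI[of _ p'] conjI impI ballI) (rule p'(1), erule found, erule none)
    next
      case False
      have "ev m \<noteq> Some (t, e)" for e
        using False Suc.prems am execution_invoke(1)[of m t] p by (cases e) auto
      then have same: "threads (\<sigma> (Suc m)) t = Busy x p" using execution_other p by simp
      have none: "effected p" if "n \<in> effect_times \<sigma> ev \<inter> steps_of ev t a" "n < Suc m" for n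
        using noeff[OF that(1)] that False by (cases "n = m") (auto simp: steps_of_def)
      have found: "\<exists>n \<in> effect_times \<sigma> ev \<inter> steps_of ev t a. n < Suc m \<and>
        (\<forall>k. x = Lookup k \<longrightarrow> (\<exists>res. p = Return res \<and>
           ((\<exists>v. res = Found v) \<longleftrightarrow> abs_has W hashcode (mem (\<sigma> n)) k)))" if "effected p"
        using eff[OF that] by (elim bexE conjE) (intro bexI conjI; simp)
      show ?thesis
        by (intro exI[of _ p] conjI impI ballI) (rule same, erule found, erule none)
    qed
  qed
qed simp

lemma execution_operations_consistent: "operations_consistent W hashcode \<sigma> ev"
  unfolding operations_consistent_def consistent_iff
proof (intro exI[of _ "effect_times \<sigma> ev"] conjI allI impI ballI)
  fix n A assume "n \<notin> effect_times \<sigma> ev" "A = {k. abs_has W hashcode (mem (\<sigma> n)) k}"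
  then show "A = {k. abs_has W hashcode (mem (\<sigma> (Suc n))) k}" by (simp add: no_effect_unchanged)
next
  fix n assume n: "n \<in> effect_times \<sigma> ev"
  then obtain t x p p' where t: "ev n = Some (t, Internal)" "threads (\<sigma> n) t = Busy x p"
    "threads (\<sigma> (Suc n)) t = Busy x p'" "\<not> effected p" "effected p'"
    by (auto simp: effect_times_def)
  obtain a where "ev a = Some (t, Invoke x)" "n \<in> steps_of ev t a"
    using invocation[OF t(2)] t(1) by (auto simp: steps_of_def)
  moreover have "effect W hashcode x (mem (\<sigma> n)) p (mem (\<sigma> (Suc n))) p'"
    using t by (elim execution_internal) simp_all
  ultimately show "\<exists>t a x. ev a = Some (t, Invoke x) \<and> n \<in> steps_of ev t a \<and>
      (\<forall>A. A = {k. abs_has W hashcode (mem (\<sigma> n)) k} \<longrightarrow>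
        abstract_op x A = {k. abs_has W hashcode (mem (\<sigma> (Suc n))) k})"
    using t(4,5) unfolding effect_def by auto
next
  fix t a x n n'
  assume a: "ev a = Some (t, Invoke x)"
    and "n \<in> effect_times \<sigma> ev \<inter> steps_of ev t a" "n' \<in> effect_times \<sigma> ev \<inter> steps_of ev t a"
  \<comment> \<open>At the later of two effect times the program counter would already be effected,
    but an effect time starts from one that is not.\<close>
  have False if n: "n \<in> effect_times \<sigma> ev \<inter> steps_of ev t a"
    and n': "n' \<in> effect_times \<sigma> ev \<inter> steps_of ev t a" and less: "n < n'" for n n'
  proof -
    have s: "a < n'" "\<forall>j res. a < j \<and> j < n' \<longrightarrow> ev j \<noteq> Some (t, Respond res)"
      "ev n' = Some (t, Internal)"
      using n' by (auto simp: steps_of_def)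
    from pending[OF a s(1,2)] obtain p where p: "threads (\<sigma> n') t = Busy x p"
      "\<forall>n \<in> effect_times \<sigma> ev \<inter> steps_of ev t a. n < n' \<longrightarrow> effected p"
      by (elim exE conjE)
    then have "effected p" using n less by blast
    then show False using p(1) n' s(3) by (auto simp: effect_times_def)
  qed
  then show "n = n'" using \<open>n \<in> _\<close> \<open>n' \<in> _\<close> by (metis linorder_neqE_nat)
next
  fix t a x b res
  assume "ev a = Some (t, Invoke x) \<and> returns ev t a b res"
  then have a: "ev a = Some (t, Invoke x)" "a < b" "ev b = Some (t, Respond res)"
    "\<forall>j res. a < j \<and> j < b \<longrightarrow> ev j \<noteq> Some (t, Respond res)"
    by (auto simp: returns_def)
  from pending[OF a(1,2,4)] obtain p where p: "threads (\<sigma> b) t = Busy x p"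
    "effected p \<longrightarrow> (\<exists>n \<in> effect_times \<sigma> ev \<inter> steps_of ev t a. n < b \<and>
      (\<forall>k. x = Lookup k \<longrightarrow> (\<exists>res. p = Return res \<and>
         ((\<exists>v. res = Found v) \<longleftrightarrow> abs_has W hashcode (mem (\<sigma> n)) k))))"
    by (elim exE conjE)
  \<comment> \<open>\<open>Return\<close> counts as effected, so a returning operation has passed
    its linearization point.\<close>
  have "p = Return res" using execution_respond(1)[OF a(3)] p(1) by auto
  with p(2) obtain n where n: "n \<in> effect_times \<sigma> ev \<inter> steps_of ev t a" "n < b"
    "\<forall>k. x = Lookup k \<longrightarrow> ((\<exists>v. res = Found v) \<longleftrightarrow> abs_has W hashcode (mem (\<sigma> n)) k)"
    by (elim impE bexE conjE) simp_all
  show "\<exists>n \<in> effect_times \<sigma> ev \<inter> steps_of ev t a. n < b \<and>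
      (\<forall>k A. x = Lookup k \<and> A = {k. abs_has W hashcode (mem (\<sigma> n)) k} \<longrightarrow>
        ((\<exists>v. res = Found v) \<longleftrightarrow> k \<in> A))"
    using n by (intro bexI[of _ n]) simp_all
qed

end

end

theorem theorem1:
  fixes W :: nat and hashcode :: "'k \<Rightarrow> nat"
    and \<sigma> :: "nat \<Rightarrow> ('t, 'k, 'v) config"
    and ev :: "nat \<Rightarrow> ('t \<times> ('k, 'v) event) option"
  assumes "W \<ge> 1"
    and "execution W hashcode \<sigma> ev"
  shows "(\<forall>n. valid W hashcode (mem (\<sigma> n)) \<and> (\<exists>A. consistent W hashcode (mem (\<sigma> n)) A)) \<and>
         operations_consistent W hashcode \<sigma> ev"
proof (intro conjI allI)
  fix n
  show "valid W hashcode (mem (\<sigma> n))"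
    using execution_config_ok[OF assms(2), of n] inv_valid unfolding config_ok_def by blast
  show "\<exists>A. consistent W hashcode (mem (\<sigma> n)) A" by (simp add: consistent_iff)
qed (rule execution_operations_consistent[OF assms(2)])

end
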